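(* Let $G$ be one of the following surface groups: (a) $\langle a_1,b_1,\ldots,a_g,b_g,y_1,\ldots,y_t,x_1,\ldots,x_m\mid\prod_{i=1}^g[a_i,b_i]=\prod_{j=1}^ty_j\cdot\prod_{i=1}^mx_i\rangle$ with $g>0$ or $t>0$; (b) $\langle a_1,\ldots,a_h,y_1,\ldots,y_t,x_1,\ldots,x_m\mid\prod_{i=1}^ha_i^2=\prod_{j=1}^ty_j\cdot\prod_{i=1}^mx_i\rangle$ with $h>1$ or $t>0$. Let $P_i$, $1\le i\le n$, be subsets of $\{x_1,x_2,\ldots,x_m\}$ such that (i) $P_i\ne\emptyset$ for each $1\le i\le n$; (ii) $P_i\cap P_j=\emptyset$ for $i\ne j$; (iii) $\bigcup_{i=1}^nP_i=\{x_1,x_2,\ldots,x_m\}$. Let $R_i=\langle\langle P_i\rangle\rangle$ be the normal closure of $P_i$ in $G$. Then $$R_1\cap R_2\cap\cdots\cap R_n=[[R_1,R_2],\ldots,R_n]_S.$$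
   Context: Here $g,h,t$ are non-negative integers, $m,n\geq 1$, and $[a,b]=a^{-1}b^{-1}ab$. The $x_1,\ldots,x_m$ are regarded as $m$ distinct generator symbols. Symmetric commutator subgroup: for subgroups $R_1,\ldots,R_n$ of a group, $$[[R_1,R_2],\ldots,R_n]_S=\prod_{\sigma\in\Sigma_n}[[R_{\sigma(1)},R_{\sigma(2)}],\ldots,R_{\sigma(n)}],$$ where $[[R_{\sigma(1)},R_{\sigma(2)}],\ldots,R_{\sigma(n)}]$ is the subgroup generated by the left iterated commutators $[[[g_1,g_2],g_3],\ldots,g_n]$ with $g_i\in R_{\sigma(i)}$; $[R_1]_S=R_1$ for $n=1$. *)

theory Defs
  imports "HOL-Algebra.Algebra" "HOL-Combinatorics.Permutations"
begin

text \<open>A word is a list of letters \<open>(x, b)\<close>, where \<open>(x, True)\<close> stands for \<open>x\<close> and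
  \<open>(x, False)\<close> for its formal inverse. The free group on \<open>S\<close> consists of the words over \<open>S\<close>
  modulo insertion and deletion of adjacent mutually inverse letters.\<close>

type_synonym 'a word = "('a \<times> bool) list"

definition words :: "'a set \<Rightarrow> 'a word set" where
  "words S = lists (S \<times> UNIV)"

inductive_set free_rel :: "'a set \<Rightarrow> ('a word \<times> 'a word) set" for S where
  free_refl: "w \<in> words S \<Longrightarrow> (w, w) \<in> free_rel S"
| free_sym: "(u, v) \<in> free_rel S \<Longrightarrow> (v, u) \<in> free_rel S"
| free_trans: "(u, v) \<in> free_rel S \<Longrightarrow> (v, w) \<in> free_rel S \<Longrightarrow> (u, w) \<in> free_rel S"
| free_cancel: "u \<in> words S \<Longrightarrow> v \<in> words S \<Longrightarrow> x \<in> S \<Longrightarrow>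
    (u @ [(x, b), (x, \<not> b)] @ v, u @ v) \<in> free_rel S"

definition word_class :: "'a set \<Rightarrow> 'a word \<Rightarrow> 'a word set" where
  "word_class S w = free_rel S `` {w}"

definition free_group :: "'a set \<Rightarrow> 'a word set monoid" where
  "free_group S = \<lparr>carrier = words S // free_rel S,
     monoid.mult = (\<lambda>U V. \<Union>u\<in>U. \<Union>v\<in>V. word_class S (u @ v)),
     one = word_class S []\<rparr>"

definition normal_closure :: "('a, 'b) monoid_scheme \<Rightarrow> 'a set \<Rightarrow> 'a set" where
  "normal_closure G A = \<Inter> {N. N \<lhd> G \<and> A \<subseteq> N}"

text \<open>A presentation is a pair \<open>(S, E)\<close> of a set of generators and a set of relations; a pair
  \<open>(u, v) \<in> E\<close> of words over \<open>S\<close> encodes the relation \<open>u = v\<close>.\<close>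

type_synonym 'a presentation = "'a set \<times> ('a word \<times> 'a word) set"

definition relators :: "'a presentation \<Rightarrow> 'a word set set" where
  "relators p = (case p of (S, E) \<Rightarrow>
     {word_class S u \<otimes>\<^bsub>free_group S\<^esub> inv\<^bsub>free_group S\<^esub> word_class S v | u v. (u, v) \<in> E})"

definition presented_group :: "'a presentation \<Rightarrow> 'a word set set monoid" where
  "presented_group p =
     free_group (fst p) Mod normal_closure (free_group (fst p)) (relators p)"

definition presented_gen :: "'a presentation \<Rightarrow> 'a \<Rightarrow> 'a word set set" where
  "presented_gen p x =
     normal_closure (free_group (fst p)) (relators p)
       #>\<^bsub>free_group (fst p)\<^esub> word_class (fst p) [(x, True)]"

definition group_comm :: "('a, 'b) monoid_scheme \<Rightarrow> 'a \<Rightarrow> 'a \<Rightarrow> 'a" where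
  "group_comm G a b = inv\<^bsub>G\<^esub> a \<otimes>\<^bsub>G\<^esub> inv\<^bsub>G\<^esub> b \<otimes>\<^bsub>G\<^esub> a \<otimes>\<^bsub>G\<^esub> b"

text \<open>\<open>[[[r 1, r 2], r 3], \<dots>, r n]\<close>, for \<open>n \<ge> 1\<close>; this is \<open>r 1\<close> if \<open>n = 1\<close>.\<close>

definition left_comm :: "('a, 'b) monoid_scheme \<Rightarrow> nat \<Rightarrow> (nat \<Rightarrow> 'a) \<Rightarrow> 'a" where
  "left_comm G n r = foldl (group_comm G) (r 1) (map r [2..<Suc n])"

definition comm_subgroup :: "('a, 'b) monoid_scheme \<Rightarrow> nat \<Rightarrow> (nat \<Rightarrow> 'a set) \<Rightarrow> 'a set" where
  "comm_subgroup G n R = generate G {left_comm G n r | r. \<forall>i\<in>{1..n}. r i \<in> R i}"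

text \<open>The product of a family of subgroups, with no order on the factors, is the subgroup they
  generate together; for normal subgroups this is the set of products in any order of the factors.\<close>

definition sym_comm_subgroup :: "('a, 'b) monoid_scheme \<Rightarrow> nat \<Rightarrow> (nat \<Rightarrow> 'a set) \<Rightarrow> 'a set" where
  "sym_comm_subgroup G n R =
     generate G (\<Union>\<sigma>\<in>{\<sigma>. \<sigma> permutes {1..n}}. comm_subgroup G n (R \<circ> \<sigma>))"

datatype surface_gen = GenA nat | GenB nat | GenY nat | GenX nat

text \<open>The word of \<open>[a\<^sub>i, b\<^sub>i] = a\<^sub>i\<^sup>-\<^sup>1 b\<^sub>i\<^sup>-\<^sup>1 a\<^sub>i b\<^sub>i\<close>.\<close>

definition comm_word :: "nat \<Rightarrow> surface_gen word" where
  "comm_word i = [(GenA i, False), (GenB i, False), (GenA i, True), (GenB i, True)]"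

definition square_word :: "nat \<Rightarrow> surface_gen word" where
  "square_word i = [(GenA i, True), (GenA i, True)]"

definition boundary_word :: "nat \<Rightarrow> nat \<Rightarrow> surface_gen word" where
  "boundary_word t m =
     map (\<lambda>j. (GenY j, True)) [1..<Suc t] @ map (\<lambda>i. (GenX i, True)) [1..<Suc m]"

definition orientable_presentation :: "nat \<Rightarrow> nat \<Rightarrow> nat \<Rightarrow> surface_gen presentation" where
  "orientable_presentation g t m =
     (GenA ` {1..g} \<union> GenB ` {1..g} \<union> GenY ` {1..t} \<union> GenX ` {1..m},
      {(concat (map comm_word [1..<Suc g]), boundary_word t m)})"

definition nonorientable_presentation :: "nat \<Rightarrow> nat \<Rightarrow> nat \<Rightarrow> surface_gen presentation" where
  "nonorientable_presentation h t m =
     (GenA ` {1..h} \<union> GenY ` {1..t} \<union> GenX ` {1..m},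
      {(concat (map square_word [1..<Suc h]), boundary_word t m)})"


lemma free_rel_words: "(u, v) \<in> free_rel S \<Longrightarrow> u \<in> words S \<and> v \<in> words S"
  by (induction rule: free_rel.induct) (auto simp: words_def)

lemma equiv_free_rel: "equiv (words S) (free_rel S)"
proof (rule equivI)
  show "free_rel S \<subseteq> words S \<times> words S" using free_rel_words by auto
  show "refl_on (words S) (free_rel S)" by (rule refl_onI) (rule free_refl)
  show "sym (free_rel S)" by (rule symI) (rule free_sym)
  show "trans (free_rel S)" by (rule transI) (rule free_trans)
qed

lemma words_Nil [simp]: "[] \<in> words S"
  by (simp add: words_def)

lemma words_append [simp]: "u @ v \<in> words S \<longleftrightarrow> u \<in> words S \<and> v \<in> words S"
  by (auto simp: words_def)

lemma free_rel_append_left: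
  "(u, v) \<in> free_rel S \<Longrightarrow> w \<in> words S \<Longrightarrow> (w @ u, w @ v) \<in> free_rel S"
proof (induction rule: free_rel.induct)
  case (free_cancel u v x b)
  then show ?case using free_rel.free_cancel[of "w @ u" S v x b] by simp
next
  case (free_refl u)
  then show ?case by (simp add: free_rel.free_refl)
next
  case (free_sym u v)
  then show ?case by (simp add: free_rel.free_sym)
next
  case (free_trans u v z)
  then show ?case by (meson free_rel.free_trans)
qed

lemma free_rel_append_right:
  "(u, v) \<in> free_rel S \<Longrightarrow> w \<in> words S \<Longrightarrow> (u @ w, v @ w) \<in> free_rel S"
proof (induction rule: free_rel.induct)
  case (free_cancel u v x b)
  then show ?case using free_rel.free_cancel[of u S "v @ w" x b] by simp
next
  case (free_refl u)
  then show ?case by (simp add: free_rel.free_refl)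
next
  case (free_sym u v)
  then show ?case by (simp add: free_rel.free_sym)
next
  case (free_trans u v z)
  then show ?case by (meson free_rel.free_trans)
qed

lemma free_rel_append:
  "(u, u') \<in> free_rel S \<Longrightarrow> (v, v') \<in> free_rel S \<Longrightarrow> (u @ v, u' @ v') \<in> free_rel S"
  using free_trans[OF free_rel_append_right[of u u' S v] free_rel_append_left[of v v' S u']]
    free_rel_words[of u u' S] free_rel_words[of v v' S] by simp

lemma word_class_eq_iff:
  "u \<in> words S \<Longrightarrow> v \<in> words S \<Longrightarrow> word_class S u = word_class S v \<longleftrightarrow> (u, v) \<in> free_rel S"
  unfolding word_class_def by (rule eq_equiv_class_iff[OF equiv_free_rel])

lemma carrier_free_group: "carrier (free_group S) = word_class S ` words S"
  by (auto simp: free_group_def quotient_def word_class_def)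

lemma one_free_group: "\<one>\<^bsub>free_group S\<^esub> = word_class S []"
  by (simp add: free_group_def)

lemma mult_free_group:
  assumes "u \<in> words S" "v \<in> words S"
  shows "word_class S u \<otimes>\<^bsub>free_group S\<^esub> word_class S v = word_class S (u @ v)"
proof -
  have const: "word_class S (u' @ v') = word_class S (u @ v)"
    if "u' \<in> word_class S u" "v' \<in> word_class S v" for u' v'
  proof -
    have "(u @ v, u' @ v') \<in> free_rel S"
      using that free_rel_append by (auto simp: word_class_def)
    then show ?thesis
      using word_class_eq_iff[of "u @ v" S "u' @ v'"] free_rel_words by blast
  qed
  have mem: "u \<in> word_class S u" "v \<in> word_class S v"
    using assms by (auto simp: word_class_def intro: free_refl)
  have inner: "(\<Union>v'\<in>word_class S v. word_class S (u' @ v')) = word_class S (u @ v)"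
    if "u' \<in> word_class S u" for u'
    using const[OF that] mem by (intro SUP_eq_const) auto
  have "(\<Union>u'\<in>word_class S u. \<Union>v'\<in>word_class S v. word_class S (u' @ v')) = word_class S (u @ v)"
    by (rule SUP_eq_const) (use mem inner in blast)+
  then show ?thesis by (simp add: free_group_def)
qed

lemma free_rel_inverse:
  "w \<in> words S \<Longrightarrow> (rev (map (\<lambda>(x, b). (x, \<not> b)) w) @ w, []) \<in> free_rel S"
proof (induction w)
  case Nil
  then show ?case by (auto intro: free_refl)
next
  case (Cons c w)
  obtain x b where c: "c = (x, b)" by (cases c)
  let ?i = "rev (map (\<lambda>(x, b). (x, \<not> b)) w)"
  have w: "w \<in> words S" "x \<in> S" using Cons.prems c by (auto simp: words_def)
  then have i: "?i \<in> words S" by (auto simp: words_def)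
  have "(?i @ [(x, \<not> b), (x, \<not> \<not> b)] @ w, ?i @ w) \<in> free_rel S"
    using i w by (intro free_cancel)
  then have "(rev (map (\<lambda>(x, b). (x, \<not> b)) (c # w)) @ c # w, ?i @ w) \<in> free_rel S"
    using c by simp
  then show ?case using Cons.IH[OF w(1)] by (rule free_trans)
qed

lemma group_free_group: "group (free_group S)"
proof (rule groupI)
  fix U assume "U \<in> carrier (free_group S)"
  then obtain u where u: "U = word_class S u" "u \<in> words S" by (auto simp: carrier_free_group)
  let ?i = "rev (map (\<lambda>(x, b). (x, \<not> b)) u)"
  have i: "?i \<in> words S" using u by (auto simp: words_def)
  have "word_class S ?i \<otimes>\<^bsub>free_group S\<^esub> U = word_class S (?i @ u)"
    using i u by (simp add: mult_free_group)
  also have "\<dots> = \<one>\<^bsub>free_group S\<^esub>"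
    using free_rel_inverse[OF u(2)] i u(2) unfolding one_free_group
    by (subst word_class_eq_iff) (simp_all add: words_def)
  finally show "\<exists>V\<in>carrier (free_group S). V \<otimes>\<^bsub>free_group S\<^esub> U = \<one>\<^bsub>free_group S\<^esub>"
    using i by (auto simp: carrier_free_group)
qed (auto simp: carrier_free_group one_free_group mult_free_group)

lemma (in group) normal_closure_normal:
  assumes "A \<subseteq> carrier G"
  shows "normal_closure G A \<lhd> G"
proof -
  have top: "carrier G \<in> {N. N \<lhd> G \<and> A \<subseteq> N}"
    using assms normal_invI[OF subgroup_self] by auto
  show ?thesis
  proof (rule normal_invI)
    show "subgroup (normal_closure G A) G"
      unfolding normal_closure_def
      by (rule subgroups_Inter) (use top normal_imp_subgroup in auto)
    show "x \<otimes> h \<otimes> inv x \<in> normal_closure G A"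
      if "x \<in> carrier G" "h \<in> normal_closure G A" for x h
      using that unfolding normal_closure_def by (auto intro: normal.inv_op_closed2)
  qed
qed

lemma relators_carrier:
  assumes "\<And>u v. (u, v) \<in> E \<Longrightarrow> u \<in> words S \<and> v \<in> words S"
  shows "relators (S, E) \<subseteq> carrier (free_group S)"
proof -
  interpret group "free_group S" by (rule group_free_group)
  have "word_class S u \<otimes>\<^bsub>free_group S\<^esub> inv\<^bsub>free_group S\<^esub> word_class S v \<in> carrier (free_group S)"
    if "(u, v) \<in> E" for u v
    using assms[OF that] by (intro m_closed inv_closed) (simp_all add: carrier_free_group)
  then show ?thesis by (auto simp: relators_def)
qed

lemma group_presented_group:
  assumes "\<And>u v. (u, v) \<in> E \<Longrightarrow> u \<in> words S \<and> v \<in> words S"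
  shows "group (presented_group (S, E))"
  unfolding presented_group_def
  using group.normal_closure_normal[OF group_free_group relators_carrier[OF assms]]
  by (auto intro: normal.factorgroup_is_group)

lemma group_orientable: "group (presented_group (orientable_presentation g t m))"
  unfolding orientable_presentation_def
  by (rule group_presented_group) (auto simp: words_def comm_word_def boundary_word_def)

lemma group_nonorientable: "group (presented_group (nonorientable_presentation h t m))"
  unfolding nonorientable_presentation_def
  by (rule group_presented_group) (auto simp: words_def square_word_def boundary_word_def)

lemma presented_gen_carrier:
  assumes "x \<in> S"
  shows "presented_gen (S, E) x \<in> carrier (presented_group (S, E))"
proof -
  have "word_class S [(x, True)] \<in> carrier (free_group S)"
    using assms by (auto simp: carrier_free_group words_def)
  then show ?thesis
    by (auto simp: presented_gen_def presented_group_def carrier_FactGroup)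
qed

end

theory Submission
  imports Defs
begin

text \<open>
  The group \<open>G\<close> is the fundamental group of a surface with boundary components or punctures, and the
  \<open>x\<^sub>i\<close> are loops around \<open>m\<close> of them. That the symmetric commutator subgroup lies in the intersection
  is clear, since the \<open>R\<^sub>i\<close> are normal. The converse has two parts.

  First, suppose that a subgroup \<open>K\<close> of \<open>G\<close> contains all \<open>R\<^sub>i\<close> and that for every \<open>j\<close> there is a
  homomorphism \<open>e\<^sub>j\<close> on \<open>K\<close> that kills \<open>R\<^sub>j\<close> and moves the elements of \<open>R\<^sub>i\<close>, for \<open>i \<noteq> j\<close>, only by
  elements of \<open>[R\<^sub>i, R\<^sub>j]\<close>. Then an induction on the number of subgroups gives the claim: an element \<open>f\<close> of
  all \<open>R\<^sub>i\<close> is by induction a product of iterated commutators that omit \<open>R\<^sub>j\<close>; applying \<open>e\<^sub>j\<close> changes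
  this product only by symmetric commutators that involve \<open>R\<^sub>j\<close> as well, and \<open>e\<^sub>j\<close> sends \<open>f\<close> to \<open>1\<close>. This
  is \<open>normal_family.Inter_subset_sym_comm\<close>; besides commutator calculus it uses the
  Hall--Witt identity.

  Second, such maps \<open>e\<^sub>j\<close> exist. If there is a generator \<open>y\<^sub>1\<close>, then \<open>G\<close> is free on the generators other
  than \<open>y\<^sub>1\<close>, and \<open>e\<^sub>j\<close> is the endomorphism of \<open>G\<close> that kills \<open>P\<^sub>j\<close> and fixes the other free
  generators. If there is no \<open>y\<^sub>1\<close>, the \<open>x\<^sub>i\<close> are the loops around all punctures of a closed surface,
  and together they are not part of a basis. But this surface has an infinite cyclic covering to which the loops
  \<open>x\<^sub>i\<close> lift, and as the covering with its punctures filled in is not compact, the loops around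
  all its punctures are part of a basis of its fundamental group \<open>K\<close>. The map \<open>e\<^sub>j\<close> kills those
  over the punctures in \<open>P\<^sub>j\<close> and fixes the rest of the basis. A sphere or a projective plane has no
  such covering, and this is why \<open>g > 0\<close> or \<open>h > 1\<close> is assumed in the absence of
  \<open>y\<^sub>1\<close>.

  The proof does not construct a basis of \<open>K\<close>. With \<open>K\<close> the kernel of \<open>\<chi> : G \<rightarrow> \<int>\<close>, the map \<open>e\<^sub>j\<close> is a
  coordinate of a homomorphism from \<open>G\<close> to the wreath product of \<open>G\<close> with \<open>\<int>\<close>, and a homomorphism on \<open>G\<close>
  is given by values on the generators that satisfy the relation. These values are the
  tautological ones, except that \<open>P\<^sub>j\<close> is sent to the identity and that the value at \<open>y\<^sub>1\<close> or
  at one handle generator is changed to restore the relation. The relation can be solved for \<open>y\<^sub>1\<close>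
  directly (\<open>deformable_boundary\<close>). In the other case one element of the handle acts as the shift of
  \<open>\<int>\<close>; so the relation is a recursion over \<open>\<int>\<close> for the coordinates of the value to be found, and it can
  always be solved (\<open>deformable_handle\<close>, \<open>deformable_Klein_handle\<close>).
\<close>

section \<open>Commutators in a group\<close>

context group
begin

lemma cancel_left_inv: "x \<in> carrier G \<Longrightarrow> y \<in> carrier G \<Longrightarrow> inv x \<otimes> (x \<otimes> y) = y"
  by (metis inv_closed l_inv l_one m_assoc)

lemma cancel_right_inv: "x \<in> carrier G \<Longrightarrow> y \<in> carrier G \<Longrightarrow> x \<otimes> (inv x \<otimes> y) = y"
  by (metis inv_closed r_inv l_one m_assoc)

text \<open>With \<open>m_assoc\<close> and \<open>inv_mult_group\<close>, the two cancellation rules bring every group word to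
  its freely reduced, right-associated form, so that rewriting with them decides the identities
  that hold in all groups.\<close>

lemmas group_word_simps = m_assoc inv_mult_group cancel_left_inv cancel_right_inv

lemma group_comm_closed [simp, intro]:
  "x \<in> carrier G \<Longrightarrow> y \<in> carrier G \<Longrightarrow> group_comm G x y \<in> carrier G"
  by (simp add: group_comm_def)

lemma inv_group_comm:
  "x \<in> carrier G \<Longrightarrow> y \<in> carrier G \<Longrightarrow> inv (group_comm G x y) = group_comm G y x"
  by (simp add: group_comm_def group_word_simps)

lemma group_comm_mult_left:
  "\<lbrakk>x \<in> carrier G; y \<in> carrier G; z \<in> carrier G\<rbrakk> \<Longrightarrow>
    group_comm G (x \<otimes> y) z = inv y \<otimes> group_comm G x z \<otimes> y \<otimes> group_comm G y z"
  by (simp add: group_comm_def group_word_simps)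

lemma group_comm_inv_left:
  "\<lbrakk>x \<in> carrier G; z \<in> carrier G\<rbrakk> \<Longrightarrow>
    group_comm G (inv x) z = x \<otimes> inv (group_comm G x z) \<otimes> inv x"
  by (simp add: group_comm_def group_word_simps)

lemma conj_group_comm:
  "\<lbrakk>g \<in> carrier G; x \<in> carrier G; y \<in> carrier G\<rbrakk> \<Longrightarrow>
    g \<otimes> group_comm G x y \<otimes> inv g =
    group_comm G (g \<otimes> x \<otimes> inv g) (g \<otimes> y \<otimes> inv g)"
  by (simp add: group_comm_def group_word_simps)

lemma Hall_Witt:
  "\<lbrakk>x \<in> carrier G; y \<in> carrier G; z \<in> carrier G\<rbrakk> \<Longrightarrow>
    (inv y \<otimes> group_comm G (group_comm G x (inv y)) z \<otimes> y) \<otimes>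
    (inv z \<otimes> group_comm G (group_comm G y (inv z)) x \<otimes> z) \<otimes>
    (inv x \<otimes> group_comm G (group_comm G z (inv x)) y \<otimes> x) = \<one>"
  by (simp add: group_comm_def group_word_simps)

lemma group_comm_normal_left:
  assumes "N \<lhd> G" "x \<in> N" "y \<in> carrier G"
  shows "group_comm G x y \<in> N"
proof -
  interpret N: normal N G by fact
  have "inv y \<otimes> x \<otimes> y \<in> N" using N.inv_op_closed1[of y x] assms by simp
  moreover have "group_comm G x y = inv x \<otimes> (inv y \<otimes> x \<otimes> y)"
    using assms N.mem_carrier by (simp add: group_comm_def group_word_simps)
  ultimately show ?thesis using assms by simp
qed

lemma group_comm_normal_right:
  assumes "N \<lhd> G" "x \<in> carrier G" "y \<in> N"
  shows "group_comm G x y \<in> N"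
proof -
  interpret N: normal N G by fact
  have "group_comm G y x \<in> N" using assms by (intro group_comm_normal_left)
  then have "inv (group_comm G y x) \<in> N" by simp
  then show ?thesis using assms N.mem_carrier by (simp add: inv_group_comm)
qed

lemma rcoset_eq_iff:
  assumes "N \<lhd> G" "x \<in> carrier G" "y \<in> carrier G"
  shows "N #> x = N #> y \<longleftrightarrow> inv x \<otimes> y \<in> N"
proof -
  interpret N: normal N G by fact
  have "N #> x = N #> y \<longleftrightarrow> y \<in> N #> x"
    using assms N.subgroup_axioms repr_independence rcos_self by metis
  also have "\<dots> \<longleftrightarrow> y \<otimes> inv x \<in> N"
    using assms N.rcos_module is_group by blast
  also have "\<dots> \<longleftrightarrow> inv x \<otimes> y \<in> N"
    using N.inv_op_closed1[of x "y \<otimes> inv x"] N.inv_op_closed2[of x "inv x \<otimes> y"] assms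
    by (auto simp: group_word_simps)
  finally show ?thesis .
qed

end

section \<open>Symmetric commutators of a family of normal subgroups\<close>

definition list_comm :: "('a, 'b) monoid_scheme \<Rightarrow> ('i \<Rightarrow> 'a) \<Rightarrow> 'i list \<Rightarrow> 'a" where
  "list_comm G r l = foldl (group_comm G) (r (hd l)) (map r (tl l))"

text \<open>Enumerations of the index set by lists, instead of permutations of \<open>{1..n}\<close>, give a version for
  arbitrary finite index sets, on which an induction can remove one index at a time.\<close>

definition sym_comm :: "('a, 'b) monoid_scheme \<Rightarrow> ('i \<Rightarrow> 'a set) \<Rightarrow> 'i set \<Rightarrow> 'a set" where
  "sym_comm G R I = generate G {list_comm G r l | r l.
     l \<noteq> [] \<and> distinct l \<and> set l = I \<and> (\<forall>i\<in>I. r i \<in> R i)}"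

lemma list_comm_singleton [simp]: "list_comm G r [a] = r a"
  by (simp add: list_comm_def)

lemma list_comm_snoc:
  "l \<noteq> [] \<Longrightarrow> list_comm G r (l @ [a]) = group_comm G (list_comm G r l) (r a)"
  by (simp add: list_comm_def)

lemma list_comm_cong:
  assumes "l \<noteq> []" "\<And>i. i \<in> set l \<Longrightarrow> r i = r' i"
  shows "list_comm G r l = list_comm G r' l"
proof -
  have "map r (tl l) = map r' (tl l)"
    using assms by (auto intro: list.set_sel(2))
  then show ?thesis using assms by (simp add: list_comm_def del: map_eq_conv)
qed

context group
begin

lemma list_comm_closed:
  "l \<noteq> [] \<Longrightarrow> (\<And>i. i \<in> set l \<Longrightarrow> r i \<in> carrier G) \<Longrightarrow> list_comm G r l \<in> carrier G"
proof (induction l rule: rev_induct)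
  case (snoc a l)
  then show ?case by (cases "l = []") (auto simp: list_comm_snoc)
qed simp

lemma conj_list_comm:
  assumes "g \<in> carrier G"
  shows "l \<noteq> [] \<Longrightarrow> (\<And>i. i \<in> set l \<Longrightarrow> r i \<in> carrier G) \<Longrightarrow>
    g \<otimes> list_comm G r l \<otimes> inv g = list_comm G (\<lambda>i. g \<otimes> r i \<otimes> inv g) l"
proof (induction l rule: rev_induct)
  case (snoc a l)
  show ?case
  proof (cases "l = []")
    case False
    then have "list_comm G r l \<in> carrier G" using snoc.prems by (intro list_comm_closed) auto
    then show ?thesis using False snoc assms by (simp add: list_comm_snoc conj_group_comm)
  qed simp
qed simp

lemma list_comm_in_normal:
  assumes "N \<lhd> G"
  shows "l \<noteq> [] \<Longrightarrow> (\<And>i. i \<in> set l \<Longrightarrow> r i \<in> carrier G) \<Longrightarrow> a \<in> set l \<Longrightarrow> r a \<in> N \<Longrightarrow>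
    list_comm G r l \<in> N"
proof (induction l rule: rev_induct)
  case (snoc b l)
  show ?case
  proof (cases "l = []")
    case False
    then have c: "list_comm G r l \<in> carrier G" using snoc.prems by (intro list_comm_closed) auto
    show ?thesis
    proof (cases "a = b")
      case True
      then show ?thesis
        using c False snoc.prems group_comm_normal_right[OF assms, of "list_comm G r l" "r b"]
        by (simp add: list_comm_snoc)
    next
      case ne: False
      then have "list_comm G r l \<in> N" using snoc False by auto
      then show ?thesis
        using False snoc.prems group_comm_normal_left[OF assms, of "list_comm G r l" "r b"]
        by (simp add: list_comm_snoc)
    qed
  qed (use snoc.prems in auto)
qed simp

lemma group_comm_generate:
  assumes N: "N \<lhd> G" and H: "H \<subseteq> carrier G" and y: "y \<in> carrier G"
    and gen: "\<And>h. h \<in> H \<Longrightarrow> group_comm G h y \<in> N"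
    and x: "x \<in> generate G H"
  shows "group_comm G x y \<in> N"
proof -
  interpret N: normal N G by fact
  show ?thesis using x
  proof (induction rule: generate.induct)
    case one
    then show ?case using y by (simp add: group_comm_def)
  next
    case (incl h)
    then show ?case by (rule gen)
  next
    case (inv h)
    then have "h \<in> carrier G" using H by blast
    moreover have "inv (group_comm G h y) \<in> N" using gen[OF inv] by simp
    ultimately show ?case
      using y N.inv_op_closed2[of h] by (simp add: group_comm_inv_left)
  next
    case (eng h1 h2)
    then have c: "h1 \<in> carrier G" "h2 \<in> carrier G"
      using generate_in_carrier[OF H] by auto
    then have "inv h2 \<otimes> group_comm G h1 y \<otimes> h2 \<in> N"
      using eng N.inv_op_closed1 by blast
    then show ?case using c y eng by (simp add: group_comm_mult_left)
  qed
qed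

end

locale normal_family = group G for G (structure) +
  fixes R :: "'i \<Rightarrow> 'a set"
  assumes normal: "R i \<lhd> G"
begin

lemma R_carrier: "x \<in> R i \<Longrightarrow> x \<in> carrier G"
  using normal_imp_subgroup[OF normal] subgroup.mem_carrier by metis

lemma sym_comm_generators_carrier:
  "{list_comm G r l | r l. l \<noteq> [] \<and> distinct l \<and> set l = I \<and> (\<forall>i\<in>I. r i \<in> R i)} \<subseteq> carrier G"
  using R_carrier by (auto intro!: list_comm_closed)

lemma list_comm_in_sym_comm:
  "l \<noteq> [] \<Longrightarrow> distinct l \<Longrightarrow> (\<And>i. i \<in> set l \<Longrightarrow> r i \<in> R i) \<Longrightarrow> list_comm G r l \<in> sym_comm G R (set l)"
  unfolding sym_comm_def by (rule generate.incl) blast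

lemma sym_comm_normal: "sym_comm G R I \<lhd> G"
  unfolding sym_comm_def
proof (rule normal_generateI[OF sym_comm_generators_carrier])
  fix h g
  assume "h \<in> {list_comm G r l | r l. l \<noteq> [] \<and> distinct l \<and> set l = I \<and> (\<forall>i\<in>I. r i \<in> R i)}"
    and g: "g \<in> carrier G"
  then obtain r l where l: "h = list_comm G r l" "l \<noteq> []" "distinct l" "set l = I" "\<forall>i\<in>I. r i \<in> R i"
    by blast
  then have "g \<otimes> h \<otimes> inv g = list_comm G (\<lambda>i. g \<otimes> r i \<otimes> inv g) l"
    using conj_list_comm[OF g] R_carrier by blast
  moreover have "\<forall>i\<in>I. g \<otimes> r i \<otimes> inv g \<in> R i"
    using l(5) g normal normal.inv_op_closed2 by metis
  ultimately show "g \<otimes> h \<otimes> inv g \<in>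
      {list_comm G r l | r l. l \<noteq> [] \<and> distinct l \<and> set l = I \<and> (\<forall>i\<in>I. r i \<in> R i)}"
    using l by blast
qed

lemma sym_comm_carrier: "x \<in> sym_comm G R I \<Longrightarrow> x \<in> carrier G"
  using normal_imp_subgroup[OF sym_comm_normal] subgroup.mem_carrier by metis

lemma sym_comm_subset:
  assumes "a \<in> I"
  shows "sym_comm G R I \<subseteq> R a"
  unfolding sym_comm_def
proof (rule generate_subgroup_incl[OF _ normal_imp_subgroup[OF normal]])
  show "{list_comm G r l | r l. l \<noteq> [] \<and> distinct l \<and> set l = I \<and> (\<forall>i\<in>I. r i \<in> R i)} \<subseteq> R a"
    using assms R_carrier by (auto intro!: list_comm_in_normal[OF normal])
qed

lemma subset_sym_comm_singleton: "R a \<subseteq> sym_comm G R {a}"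
proof
  fix x assume "x \<in> R a"
  then show "x \<in> sym_comm G R {a}" using list_comm_in_sym_comm[of "[a]" "\<lambda>_. x"] by simp
qed

lemma group_comm_sym_comm:
  assumes "s \<in> sym_comm G R I" "r \<in> R a" "a \<notin> I"
  shows "group_comm G s r \<in> sym_comm G R (insert a I)"
proof (rule group_comm_generate[OF sym_comm_normal sym_comm_generators_carrier])
  show "r \<in> carrier G" using assms R_carrier by blast
  show "s \<in> generate G {list_comm G r l | r l. l \<noteq> [] \<and> distinct l \<and> set l = I \<and> (\<forall>i\<in>I. r i \<in> R i)}"
    using assms by (simp add: sym_comm_def)
next
  fix h assume "h \<in> {list_comm G r l | r l. l \<noteq> [] \<and> distinct l \<and> set l = I \<and> (\<forall>i\<in>I. r i \<in> R i)}"
  then obtain r' l where l: "h = list_comm G r' l" "l \<noteq> []" "distinct l" "set l = I" "\<forall>i\<in>I. r' i \<in> R i"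
    by blast
  have "list_comm G (r'(a := r)) l = h"
    using l assms by (auto intro: list_comm_cong)
  then have "group_comm G h r = list_comm G (r'(a := r)) (l @ [a])"
    using l by (simp add: list_comm_snoc)
  moreover have "list_comm G (r'(a := r)) (l @ [a]) \<in> sym_comm G R (set (l @ [a]))"
    using l assms by (intro list_comm_in_sym_comm) auto
  ultimately show "group_comm G h r \<in> sym_comm G R (insert a I)" using l by simp
qed

text \<open>An instance of the three subgroups lemma. On generators \<open>q = [x, y]\<close> the Hall--Witt identity
  expresses \<open>[[x, y], s]\<close> through conjugates of \<open>[[y, s], x]\<close> and \<open>[[s, x], y]\<close>, up to inverses of
  the entries, and in these two \<open>x\<close> and \<open>y\<close> are appended to \<open>s\<close> one after the other. The case is
  needed because a retraction moves an entry of an iterated commutator by a factor which is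
  itself a commutator.\<close>

lemma group_comm_sym_comm_pair:
  assumes s: "s \<in> sym_comm G R I" and q: "q \<in> sym_comm G R {a, b}" and ab: "a \<notin> I" "b \<notin> I" "a \<noteq> b"
  shows "group_comm G q s \<in> sym_comm G R (insert a (insert b I))"
proof -
  let ?N = "sym_comm G R (insert a (insert b I))"
  interpret N: normal ?N G by (rule sym_comm_normal)
  have sc: "s \<in> carrier G" using s sym_comm_carrier by blast
  have pair: "group_comm G (group_comm G x y) s \<in> ?N"
    if x: "x \<in> R i" and y: "y \<in> R j" and ij: "i = a \<and> j = b \<or> i = b \<and> j = a" for x y i j
  proof -
    have c: "x \<in> carrier G" "y \<in> carrier G" using x y R_carrier by auto
    have sets: "insert i (insert j I) = insert a (insert b I)" "insert j (insert i I) = insert a (insert b I)"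
      and notin: "i \<notin> I" "j \<notin> I" "i \<noteq> j"
      using ij ab by auto
    interpret Ri: normal "R i" G by (rule normal)
    interpret Rj: normal "R j" G by (rule normal)
    interpret T: normal "sym_comm G R I" G by (rule sym_comm_normal)
    interpret Tj: normal "sym_comm G R (insert j I)" G by (rule sym_comm_normal)
    let ?A = "group_comm G (group_comm G x y) s"
    let ?B = "group_comm G (group_comm G (inv y) (inv s)) x"
    let ?C = "group_comm G (group_comm G s (inv x)) (inv y)"
    have "group_comm G (inv s) (inv y) \<in> sym_comm G R (insert j I)"
      using s y notin by (intro group_comm_sym_comm) auto
    then have "group_comm G (inv y) (inv s) \<in> sym_comm G R (insert j I)"
      using inv_group_comm[of "inv s" "inv y"] Tj.m_inv_closed sc c by (metis inv_closed)
    then have B: "?B \<in> ?N"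
      using group_comm_sym_comm[of _ "insert j I" x i] x notin sets by simp
    have "group_comm G s (inv x) \<in> sym_comm G R (insert i I)"
      using s x notin by (intro group_comm_sym_comm) auto
    then have C: "?C \<in> ?N"
      using group_comm_sym_comm[of _ "insert i I" "inv y" j] y notin sets by simp
    have Ac: "?A \<in> carrier G" "?B \<in> carrier G" "?C \<in> carrier G" using c sc by auto
    have "(y \<otimes> ?A \<otimes> inv y) \<otimes> (inv s \<otimes> ?B \<otimes> s) \<otimes> (inv x \<otimes> ?C \<otimes> x) = \<one>"
      using Hall_Witt[of x "inv y" s] c sc by simp
    then have "y \<otimes> ?A \<otimes> inv y = inv ((inv s \<otimes> ?B \<otimes> s) \<otimes> (inv x \<otimes> ?C \<otimes> x))"
      using Ac c sc by (intro inv_equality[symmetric]) (simp_all add: m_assoc)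
    also have "\<dots> \<in> ?N"
      using N.inv_op_closed1[OF sc B] N.inv_op_closed1[OF c(1) C] by simp
    finally have "inv y \<otimes> (y \<otimes> ?A \<otimes> inv y) \<otimes> y \<in> ?N"
      using N.inv_op_closed1 c by blast
    moreover have "inv y \<otimes> (y \<otimes> ?A \<otimes> inv y) \<otimes> y = ?A"
      using Ac(1) c by (simp add: group_word_simps)
    ultimately show ?thesis by simp
  qed
  show ?thesis
  proof (rule group_comm_generate[OF sym_comm_normal sym_comm_generators_carrier sc])
    show "q \<in> generate G {list_comm G r l | r l. l \<noteq> [] \<and> distinct l \<and> set l = {a, b} \<and> (\<forall>i\<in>{a, b}. r i \<in> R i)}"
      using q by (simp add: sym_comm_def)
  next
    fix h assume "h \<in> {list_comm G r l | r l. l \<noteq> [] \<and> distinct l \<and> set l = {a, b} \<and> (\<forall>i\<in>{a, b}. r i \<in> R i)}"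
    then obtain r l where l: "h = list_comm G r l" "l \<noteq> []" "distinct l" "set l = {a, b}" "\<forall>i\<in>{a, b}. r i \<in> R i"
      by blast
    \<comment> \<open>For a two-element index set the generators are the plain commutators in either order.\<close>
    have "length l = 2" using distinct_card[OF l(3)] l(4) ab by simp
    then obtain i j where "l = [i, j]"
      by (auto simp: length_Suc_conv numeral_2_eq_2)
    moreover from this have "i = a \<and> j = b \<or> i = b \<and> j = a" using l(3,4) by (auto simp: doubleton_eq_iff)
    ultimately show "group_comm G h s \<in> ?N"
      using l pair[of "r i" i "r j" j] by (auto simp: list_comm_def)
  qed
qed

end

section \<open>Retractions force the intersection into the symmetric commutator subgroup\<close>

context group
begin

lemma group_comm_eq_one_iff:
  assumes "x \<in> carrier G" "y \<in> carrier G"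
  shows "group_comm G x y = \<one> \<longleftrightarrow> x \<otimes> y = y \<otimes> x"
proof -
  have "y \<otimes> x \<otimes> group_comm G x y = x \<otimes> y"
    using assms by (simp add: group_comm_def group_word_simps)
  moreover have "y \<otimes> x \<otimes> group_comm G x y = y \<otimes> x \<longleftrightarrow> group_comm G x y = \<one>"
    using assms by simp
  ultimately show ?thesis by simp
qed

lemma group_comm_unique:
  assumes "x \<in> carrier G" "y \<in> carrier G" "d \<in> carrier G" "x \<otimes> y = y \<otimes> x \<otimes> d"
  shows "group_comm G x y = d"
proof -
  have "group_comm G x y = inv x \<otimes> inv y \<otimes> (x \<otimes> y)"
    using assms(1,2) by (simp add: group_comm_def m_assoc)
  also have "\<dots> = d"
    unfolding assms(4) using assms(1,2,3) by (simp add: group_word_simps)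
  finally show ?thesis .
qed

text \<open>The factors \<open>s\<close> and \<open>q\<close> drop out of the commutator because \<open>s\<close> commutes with \<open>r\<close>, \<open>q\<close> and
  \<open>[t, r]\<close>, and \<open>q\<close> commutes with \<open>t\<close> and \<open>[t, r]\<close>. In the application \<open>t s\<close> and \<open>r q\<close> are the images
  of \<open>t\<close> and \<open>r\<close> under a retraction, in a quotient in which all these commutators vanish.\<close>

lemma group_comm_absorb:
  assumes c: "t \<in> carrier G" "s \<in> carrier G" "r \<in> carrier G" "q \<in> carrier G"
    and sr: "group_comm G s r = \<one>" and sq: "group_comm G s q = \<one>" and qt: "group_comm G q t = \<one>"
    and tq: "group_comm G (group_comm G t r) q = \<one>" and ts: "group_comm G s (group_comm G t r) = \<one>"
  shows "group_comm G (t \<otimes> s) (r \<otimes> q) = group_comm G t r"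
proof -
  define d where "d = group_comm G t r"
  have d: "d \<in> carrier G" "r \<otimes> (t \<otimes> d) = t \<otimes> r"
    using c unfolding d_def by (simp_all add: group_comm_def group_word_simps)
  have comm: "s \<otimes> r = r \<otimes> s" "s \<otimes> q = q \<otimes> s" "q \<otimes> t = t \<otimes> q" "d \<otimes> q = q \<otimes> d" "s \<otimes> d = d \<otimes> s"
    using sr sq qt tq ts c d(1) by (simp_all add: group_comm_eq_one_iff flip: d_def)
  have "(t \<otimes> s) \<otimes> (r \<otimes> q) = t \<otimes> (s \<otimes> r) \<otimes> q" using c by (simp add: m_assoc)
  also have "\<dots> = t \<otimes> r \<otimes> (s \<otimes> q)" using c comm(1) by (simp add: m_assoc)
  also have "\<dots> = (r \<otimes> (t \<otimes> d)) \<otimes> (q \<otimes> s)" using comm(2) d by simp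
  also have "\<dots> = r \<otimes> t \<otimes> (d \<otimes> q) \<otimes> s" using c d(1) by (simp add: m_assoc)
  also have "\<dots> = r \<otimes> (t \<otimes> q) \<otimes> (d \<otimes> s)" using c d(1) comm(4) by (simp add: m_assoc)
  also have "\<dots> = r \<otimes> (q \<otimes> t) \<otimes> (s \<otimes> d)" using comm by simp
  also have "\<dots> = (r \<otimes> q) \<otimes> (t \<otimes> s) \<otimes> d" using c d(1) by (simp add: m_assoc)
  finally have "(t \<otimes> s) \<otimes> (r \<otimes> q) = (r \<otimes> q) \<otimes> (t \<otimes> s) \<otimes> d" .
  then show ?thesis
    unfolding d_def[symmetric] using c d(1) by (intro group_comm_unique) simp_all
qed

end

lemma (in group_hom) hom_group_comm:
  "x \<in> carrier G \<Longrightarrow> y \<in> carrier G \<Longrightarrow> h (group_comm G x y) = group_comm H (h x) (h y)"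
  by (simp add: group_comm_def)

lemma (in normal) coset_group_hom: "group_hom G (G Mod H) (\<lambda>x. H #> x)"
  by (intro group_hom.intro group_hom_axioms.intro factorgroup_is_group is_group r_coset_hom_Mod)

lemma (in group) group_comm_absorb_mod:
  assumes N: "N \<lhd> G"
    and c: "t \<in> carrier G" "s \<in> carrier G" "r \<in> carrier G" "q \<in> carrier G"
    and "group_comm G s r \<in> N" "group_comm G s q \<in> N" "group_comm G q t \<in> N"
    and "group_comm G (group_comm G t r) q \<in> N" "group_comm G s (group_comm G t r) \<in> N"
  shows "inv (group_comm G t r) \<otimes> group_comm G (t \<otimes> s) (r \<otimes> q) \<in> N"
proof -
  interpret N: normal N G by fact
  interpret Q: group_hom G "G Mod N" "\<lambda>x. N #> x" by (rule N.coset_group_hom)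
  have one: "N #> x = \<one>\<^bsub>G Mod N\<^esub>" if "x \<in> N" for x
    using that N.rcos_const is_group by simp
  have "group_comm (G Mod N) ((N #> t) \<otimes>\<^bsub>G Mod N\<^esub> (N #> s)) ((N #> r) \<otimes>\<^bsub>G Mod N\<^esub> (N #> q))
      = group_comm (G Mod N) (N #> t) (N #> r)"
    using assms by (intro Q.H.group_comm_absorb) (simp_all add: one flip: Q.hom_group_comm del: one_FactGroup)
  then have "N #> group_comm G t r = N #> group_comm G (t \<otimes> s) (r \<otimes> q)"
    using c by (simp add: Q.hom_group_comm del: mult_FactGroup)
  then show ?thesis using c by (subst rcoset_eq_iff[OF N, symmetric]) auto
qed

text \<open>That the congruence \<open>e x = x\<close> modulo \<open>N\<close> defines a subgroup makes it enough to verify it on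
  generators.\<close>

lemma (in group) subgroup_hom_congruent:
  assumes K: "subgroup K G" and e: "e \<in> hom (G\<lparr>carrier := K\<rparr>) G" and N: "N \<lhd> G"
  shows "subgroup {x \<in> K. inv x \<otimes> e x \<in> N} G"
proof -
  interpret K: subgroup K G by (rule K)
  interpret N: normal N G by (rule N)
  interpret E: group_hom "G\<lparr>carrier := K\<rparr>" G e
    by (intro group_hom.intro group_hom_axioms.intro e K.subgroup_is_group is_group)
  have e_carrier: "e x \<in> carrier G" if "x \<in> K" for x using E.hom_closed that by simp
  have e_mult: "e (x \<otimes> y) = e x \<otimes> e y" if "x \<in> K" "y \<in> K" for x y
    using that E.hom_mult by simp
  have e_inv: "e (inv x) = inv (e x)" if "x \<in> K" for x
    using that E.hom_inv m_inv_consistent[OF K] by simp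
  have e_one: "e \<one> = \<one>" using E.hom_one by simp
  show ?thesis
  proof (rule subgroupI)
    show "{x \<in> K. inv x \<otimes> e x \<in> N} \<noteq> {}" using e_one by (auto intro!: exI[of _ \<one>])
  next
    fix x assume x: "x \<in> {x \<in> K. inv x \<otimes> e x \<in> N}"
    then have "x \<otimes> inv (inv x \<otimes> e x) \<otimes> inv x \<in> N"
      using N.inv_op_closed2[of x "inv (inv x \<otimes> e x)"] by simp
    also have "x \<otimes> inv (inv x \<otimes> e x) \<otimes> inv x = inv (inv x) \<otimes> e (inv x)"
      using x e_carrier by (simp add: group_word_simps e_inv)
    finally show "inv x \<in> {x \<in> K. inv x \<otimes> e x \<in> N}" using x by simp
  next
    fix x y assume x: "x \<in> {x \<in> K. inv x \<otimes> e x \<in> N}" and y: "y \<in> {x \<in> K. inv x \<otimes> e x \<in> N}"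
    then have "(inv y \<otimes> (inv x \<otimes> e x) \<otimes> y) \<otimes> (inv y \<otimes> e y) \<in> N"
      using N.inv_op_closed1[of y "inv x \<otimes> e x"] by simp
    also have "(inv y \<otimes> (inv x \<otimes> e x) \<otimes> y) \<otimes> (inv y \<otimes> e y) = inv (x \<otimes> y) \<otimes> e (x \<otimes> y)"
      using x y e_carrier by (simp add: group_word_simps e_mult)
    finally show "x \<otimes> y \<in> {x \<in> K. inv x \<otimes> e x \<in> N}" using x y by simp
  qed auto
qed

context normal_family
begin

text \<open>By induction on the index set. Suppose the claim for \<open>I\<close>, and let \<open>f\<close> lie in all \<open>R i\<close> with
  \<open>i \<in> I\<close> and in \<open>R j\<close>. By induction \<open>f\<close> is a product of iterated commutators of elements
  \<open>r i \<in> R i\<close>. The map \<open>e j\<close> replaces each \<open>r i\<close> by \<open>r i\<close> times an element of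
  \<open>sym_comm G R {i, j}\<close>, and this changes the iterated commutator only within
  \<open>sym_comm G R (insert j I)\<close>. So \<open>e j f\<close> and \<open>f\<close> are congruent modulo that subgroup; but
  \<open>e j f = \<one>\<close>, since \<open>f \<in> R j\<close>.\<close>

theorem Inter_subset_sym_comm:
  assumes K: "\<And>j. subgroup (K j) G" "\<And>i j. R i \<subseteq> K j"
    and e: "\<And>j. e j \<in> hom (G\<lparr>carrier := K j\<rparr>) G"
    and kill: "\<And>j x. x \<in> R j \<Longrightarrow> e j x = \<one>"
    and keep: "\<And>i j x. i \<noteq> j \<Longrightarrow> x \<in> R i \<Longrightarrow> inv x \<otimes> e j x \<in> sym_comm G R {i, j}"
    and I: "finite I" "I \<noteq> {}"
  shows "(\<Inter>i\<in>I. R i) \<subseteq> sym_comm G R I"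
  using I
proof (induction I rule: finite_ne_induct)
  case (singleton a)
  then show ?case using subset_sym_comm_singleton by simp
next
  case (insert j I)
  interpret K: subgroup "K j" G by (rule K)
  interpret E: group_hom "G\<lparr>carrier := K j\<rparr>" G "e j"
    by (intro group_hom.intro group_hom_axioms.intro e K.subgroup_is_group is_group)
  have Kin: "x \<in> K j" if "x \<in> R i" for x i using K(2) that by blast
  have R_e: "e j x \<in> carrier G" if "x \<in> K j" for x using E.hom_closed that by simp
  have e_mult: "e j (x \<otimes> y) = e j x \<otimes> e j y" if "x \<in> K j" "y \<in> K j" for x y
    using that E.hom_mult by simp
  have e_inv: "e j (inv x) = inv (e j x)" if "x \<in> K j" for x
    using that E.hom_inv m_inv_consistent[OF K(1)] by simp
  have e_comm: "e j (group_comm G x y) = group_comm G (e j x) (e j y)"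
    if "x \<in> K j" "y \<in> K j" for x y
    using that by (simp add: group_comm_def e_mult e_inv)
  \<comment> \<open>The effect of \<open>e j\<close> on one iterated commutator, by appending its entries one at a time.\<close>
  have step: "list_comm G r l \<in> K j \<and> inv (list_comm G r l) \<otimes> e j (list_comm G r l) \<in> sym_comm G R (Set.insert j (set l))"
    if "l \<noteq> []" "distinct l" "j \<notin> set l" "\<And>i. i \<in> set l \<Longrightarrow> r i \<in> R i" for r l
    using that
  proof (induction l rule: rev_induct)
    case (snoc a l)
    show ?case
    proof (cases "l = []")
      case True
      then show ?thesis
        using snoc.prems keep[of a j "r a"] Kin[of "r a" a] by (simp add: insert_commute)
    next
      case False
      let ?t = "list_comm G r l"
      let ?N = "sym_comm G R (Set.insert j (set (l @ [a])))"
      let ?q = "inv (r a) \<otimes> e j (r a)"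
      let ?s = "inv ?t \<otimes> e j ?t"
      have IH: "?t \<in> K j" "?s \<in> sym_comm G R (Set.insert j (set l))" using snoc False by auto
      have ra: "r a \<in> R a" "a \<noteq> j" "a \<notin> set l" "j \<notin> set l" using snoc.prems by auto
      have t: "?t \<in> sym_comm G R (set l)" using snoc.prems False by (intro list_comm_in_sym_comm) auto
      have q: "?q \<in> sym_comm G R {a, j}" using keep ra by simp
      have qa: "?q \<in> R a" and qj: "?q \<in> R j" using q sym_comm_subset[of _ "{a, j}"] by blast+
      have sets: "Set.insert j (set (l @ [a])) = Set.insert a (Set.insert j (set l))"
        "Set.insert j (set (l @ [a])) = Set.insert j (Set.insert a (set l))" by auto
      have c: "?t \<in> carrier G" "?s \<in> carrier G" "r a \<in> carrier G" "?q \<in> carrier G"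
        using sym_comm_carrier[OF t] sym_comm_carrier[OF IH(2)] R_carrier[OF ra(1)] sym_comm_carrier[OF q]
        by auto
      have tr: "group_comm G ?t (r a) \<in> sym_comm G R (Set.insert a (set l))"
        using group_comm_sym_comm[OF t ra(1) ra(3)] .
      \<comment> \<open>Here \<open>e j\<close> maps \<open>t\<close> to \<open>t s\<close> and \<open>r a\<close> to \<open>r a q\<close>, and both deviations are absorbed modulo \<open>?N\<close>.\<close>
      have "inv (group_comm G ?t (r a)) \<otimes> group_comm G (?t \<otimes> ?s) (r a \<otimes> ?q) \<in> ?N"
      proof (rule group_comm_absorb_mod[OF sym_comm_normal c])
        have *: "group_comm G ?s x \<in> ?N" if "x \<in> R a" for x
          unfolding sets(1) using group_comm_sym_comm[OF IH(2) that] ra by simp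
        show "group_comm G ?s (r a) \<in> ?N" "group_comm G ?s ?q \<in> ?N" using * ra(1) qa by auto
        show "group_comm G ?q ?t \<in> ?N"
          unfolding sets(1) using group_comm_sym_comm_pair[OF t q] ra by simp
        show "group_comm G (group_comm G ?t (r a)) ?q \<in> ?N"
          unfolding sets(2) using group_comm_sym_comm[OF tr qj] ra by simp
        show "group_comm G ?s (group_comm G ?t (r a)) \<in> ?N"
          using * tr sym_comm_subset[of a "Set.insert a (set l)"] by auto
      qed
      moreover have "?t \<otimes> ?s = e j ?t" "r a \<otimes> ?q = e j (r a)"
        using c(1,3) R_e IH(1) Kin[OF ra(1)] by (simp_all add: group_word_simps)
      moreover have "group_comm G ?t (r a) \<in> K j"
        using IH(1) Kin[OF ra(1)] unfolding group_comm_def by simp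
      ultimately show ?thesis
        using False IH(1) Kin[OF ra(1)] by (simp add: list_comm_snoc e_comm)
    qed
  qed simp
  let ?N = "sym_comm G R (Set.insert j I)"
  interpret N: normal ?N G by (rule sym_comm_normal)
  have "sym_comm G R I \<subseteq> {x \<in> K j. inv x \<otimes> e j x \<in> ?N}"
    unfolding sym_comm_def[of G R I]
  proof (rule generate_subgroup_incl[OF subsetI subgroup_hom_congruent[OF K(1) e sym_comm_normal]])
    fix h assume "h \<in> {list_comm G r l | r l. l \<noteq> [] \<and> distinct l \<and> set l = I \<and> (\<forall>i\<in>I. r i \<in> R i)}"
    then obtain r l where l: "h = list_comm G r l" "l \<noteq> []" "distinct l" "set l = I" "\<forall>i\<in>I. r i \<in> R i"
      by blast
    then show "h \<in> {x \<in> K j. inv x \<otimes> e j x \<in> ?N}" using step[of l r] insert.hyps by blast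
  qed
  then have gen: "inv x \<otimes> e j x \<in> ?N" if "x \<in> sym_comm G R I" for x
    using that by blast
  show ?case
  proof
    fix f assume f: "f \<in> (\<Inter>i\<in>Set.insert j I. R i)"
    then have "f \<in> sym_comm G R I" using insert.IH by auto
    then have "inv f \<otimes> e j f \<in> ?N" using gen by blast
    moreover have "e j f = \<one>" using f kill by simp
    moreover have "f \<in> carrier G" using f R_carrier[of f j] by auto
    ultimately have "inv f \<in> ?N" by simp
    then have "inv (inv f) \<in> ?N" by (rule N.m_inv_closed)
    then show "f \<in> ?N" using \<open>f \<in> carrier G\<close> by simp
  qed
qed

end

section \<open>Retractions from deformed cocycles over the integers\<close>

text \<open>The unrestricted wreath product of \<open>G\<close> with the integers. A homomorphism from \<open>G\<close> to it consists of
  a homomorphism \<open>\<chi>\<close> to the integers and a cocycle, that is, elements \<open>c\<^sub>g k\<close> with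
  \<open>c\<^bsub>gh\<^esub> k = c\<^sub>g k \<cdot> c\<^sub>h (k + \<chi> g)\<close>. Coordinate \<open>0\<close> of a cocycle is a homomorphism on the kernel of
  \<open>\<chi>\<close>. In this way homomorphisms defined only on that kernel, of which no presentation is at hand,
  can be described by values on the generators of \<open>G\<close>.\<close>

definition shift_wreath :: "('a, 'b) monoid_scheme \<Rightarrow> ((int \<Rightarrow> 'a) \<times> int) monoid" where
  "shift_wreath G = \<lparr>carrier = {(f, k). \<forall>i. f i \<in> carrier G},
     monoid.mult = (\<lambda>(f, k) (f', k'). (\<lambda>i. f i \<otimes>\<^bsub>G\<^esub> f' (i + k), k + k')),
     one = (\<lambda>_. \<one>\<^bsub>G\<^esub>, 0)\<rparr>"

lemma carrier_shift_wreath: "(f, k) \<in> carrier (shift_wreath G) \<longleftrightarrow> (\<forall>i. f i \<in> carrier G)"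
  by (simp add: shift_wreath_def)

lemma mult_shift_wreath:
  "(f, k) \<otimes>\<^bsub>shift_wreath G\<^esub> (f', k') = (\<lambda>i. f i \<otimes>\<^bsub>G\<^esub> f' (i + k), k + k')"
  by (simp add: shift_wreath_def)

lemma one_shift_wreath: "\<one>\<^bsub>shift_wreath G\<^esub> = (\<lambda>_. \<one>\<^bsub>G\<^esub>, 0)"
  by (simp add: shift_wreath_def)

lemma (in group) group_shift_wreath: "group (shift_wreath G)"
proof (rule groupI)
  fix x assume "x \<in> carrier (shift_wreath G)"
  then obtain f k where x: "x = (f, k)" "\<And>i. f i \<in> carrier G"
    by (cases x) (auto simp: carrier_shift_wreath)
  have "(\<lambda>i. inv (f (i - k)), - k) \<otimes>\<^bsub>shift_wreath G\<^esub> x = \<one>\<^bsub>shift_wreath G\<^esub>"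
    using x by (simp add: mult_shift_wreath one_shift_wreath)
  then show "\<exists>y\<in>carrier (shift_wreath G). y \<otimes>\<^bsub>shift_wreath G\<^esub> x = \<one>\<^bsub>shift_wreath G\<^esub>"
    using x by (intro bexI[of _ "(\<lambda>i. inv (f (i - k)), - k)"]) (auto simp: carrier_shift_wreath)
qed (auto simp: shift_wreath_def m_assoc add.assoc)

lemma (in group) inv_shift_wreath:
  assumes "\<And>i. f i \<in> carrier G"
  shows "inv\<^bsub>shift_wreath G\<^esub> (f, k) = (\<lambda>i. inv (f (i - k)), - k)"
proof (rule group.inv_equality[OF group_shift_wreath])
  show "(\<lambda>i. inv (f (i - k)), - k) \<otimes>\<^bsub>shift_wreath G\<^esub> (f, k) = \<one>\<^bsub>shift_wreath G\<^esub>"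
    using assms by (simp add: mult_shift_wreath one_shift_wreath)
qed (use assms in \<open>auto simp: carrier_shift_wreath\<close>)

definition map_wreath :: "('a \<Rightarrow> 'b) \<Rightarrow> (int \<Rightarrow> 'a) \<times> int \<Rightarrow> (int \<Rightarrow> 'b) \<times> int" where
  "map_wreath h = (\<lambda>(f, k). (\<lambda>i. h (f i), k))"

lemma map_wreath_simp [simp]: "map_wreath h (f, k) = (\<lambda>i. h (f i), k)"
  by (simp add: map_wreath_def)

lemma map_wreath_hom:
  "h \<in> hom G H \<Longrightarrow> map_wreath h \<in> hom (shift_wreath G) (shift_wreath H)"
  by (auto simp: hom_def shift_wreath_def map_wreath_def)

text \<open>The tautological cocycle: for \<open>\<chi> b = 1\<close> its coordinate \<open>k\<close> at \<open>g\<close> expresses \<open>g\<close> in the kernel of \<open>\<chi>\<close>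
  along the transversal of the powers of \<open>b\<close>. On the kernel of
  \<open>\<chi>\<close> its coordinate \<open>0\<close> is the identity map.\<close>

definition shift_conj ::
  "('a, 'c) monoid_scheme \<Rightarrow> 'a \<Rightarrow> ('a \<Rightarrow> int) \<Rightarrow> 'a \<Rightarrow> (int \<Rightarrow> 'a) \<times> int" where
  "shift_conj G b \<chi> g =
     (\<lambda>k. b [^]\<^bsub>G\<^esub> k \<otimes>\<^bsub>G\<^esub> g \<otimes>\<^bsub>G\<^esub> inv\<^bsub>G\<^esub> (b [^]\<^bsub>G\<^esub> (k + \<chi> g)), \<chi> g)"

context group
begin

lemma shift_conj_hom:
  assumes "b \<in> carrier G" "\<chi> \<in> hom G integer_group"
  shows "shift_conj G b \<chi> \<in> hom G (shift_wreath G)"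
proof (rule homI)
  fix g h assume gh: "g \<in> carrier G" "h \<in> carrier G"
  have "\<chi> (g \<otimes> h) = \<chi> g + \<chi> h" using assms gh by (simp add: hom_mult)
  then show "shift_conj G b \<chi> (g \<otimes> h) = shift_conj G b \<chi> g \<otimes>\<^bsub>shift_wreath G\<^esub> shift_conj G b \<chi> h"
    using assms gh by (simp add: shift_conj_def mult_shift_wreath group_word_simps add.assoc)
qed (use assms in \<open>simp add: shift_conj_def carrier_shift_wreath\<close>)

lemma subset_normal_closure: "A \<subseteq> normal_closure G A"
  unfolding normal_closure_def by blast

lemma normal_closure_least:
  assumes A: "A \<subseteq> carrier G" and H: "subgroup H G"
    and conj: "\<And>g a. g \<in> carrier G \<Longrightarrow> a \<in> A \<Longrightarrow> g \<otimes> a \<otimes> inv g \<in> H"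
  shows "normal_closure G A \<subseteq> H"
proof -
  let ?C = "{g \<otimes> a \<otimes> inv g | g a. g \<in> carrier G \<and> a \<in> A}"
  have C: "?C \<subseteq> carrier G" using A by auto
  have "generate G ?C \<lhd> G"
  proof (rule normal_generateI[OF C])
    fix h g assume "h \<in> ?C" and g: "g \<in> carrier G"
    then obtain g' a where h: "h = g' \<otimes> a \<otimes> inv g'" "g' \<in> carrier G" "a \<in> A" by blast
    then have "g \<otimes> h \<otimes> inv g = (g \<otimes> g') \<otimes> a \<otimes> inv (g \<otimes> g')"
      using g A by (simp add: group_word_simps subset_iff)
    then show "g \<otimes> h \<otimes> inv g \<in> ?C" using h g by blast
  qed
  moreover have "A \<subseteq> generate G ?C"
  proof
    fix a assume "a \<in> A"
    then have "a = \<one> \<otimes> a \<otimes> inv \<one>" "a \<in> A" using A by auto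
    then have "a \<in> ?C" by blast
    then show "a \<in> generate G ?C" by (rule generate.incl)
  qed
  ultimately have "normal_closure G A \<subseteq> generate G ?C" unfolding normal_closure_def by blast
  also have "\<dots> \<subseteq> H" using conj by (intro generate_subgroup_incl[OF _ H]) auto
  finally show ?thesis .
qed

end

text \<open>A cocycle that kills \<open>A\<close> but does not differ from the tautological one modulo the normal closure
  \<open>N\<close> of \<open>A\<close>. Its coordinate \<open>0\<close> restricts to a homomorphism \<open>e\<close> on the kernel \<open>K\<close> of \<open>\<chi>\<close> that is
  the identity modulo \<open>N\<close>.\<close>

locale shift_deformation = group G for G (structure) +
  fixes b :: 'a and \<chi> :: "'a \<Rightarrow> int" and A :: "'a set" and \<Psi> :: "'a \<Rightarrow> (int \<Rightarrow> 'a) \<times> int"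
  assumes b: "b \<in> carrier G" and chi: "\<chi> \<in> hom G integer_group" and A: "A \<subseteq> carrier G"
    and Psi: "\<Psi> \<in> hom G (shift_wreath G)"
    and congruent: "\<And>g. g \<in> carrier G \<Longrightarrow>
      map_wreath (\<lambda>x. normal_closure G A #> x) (\<Psi> g) =
      map_wreath (\<lambda>x. normal_closure G A #> x) (shift_conj G b \<chi> g)"
    and trivial: "\<And>x. x \<in> A \<Longrightarrow> \<Psi> x = \<one>\<^bsub>shift_wreath G\<^esub>"
begin

abbreviation N where "N \<equiv> normal_closure G A"
abbreviation K where "K \<equiv> {g \<in> carrier G. \<chi> g = 0}"
abbreviation e where "e g \<equiv> fst (\<Psi> g) 0"

sublocale chi: group_hom G integer_group \<chi>
  by (intro group_hom.intro group_hom_axioms.intro is_group group_integer_group chi)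

sublocale Psi: group_hom G "shift_wreath G" \<Psi>
  by (intro group_hom.intro group_hom_axioms.intro is_group group_shift_wreath Psi)

lemma Psi_eq: "g \<in> carrier G \<Longrightarrow> \<Psi> g = (fst (\<Psi> g), \<chi> g)"
  using congruent[of g] by (simp add: map_wreath_def shift_conj_def split: prod.splits)

lemma fst_Psi_closed: "g \<in> carrier G \<Longrightarrow> fst (\<Psi> g) i \<in> carrier G"
  using Psi.hom_closed[of g] by (cases "\<Psi> g") (simp add: carrier_shift_wreath)

lemma fst_Psi_coset:
  "g \<in> carrier G \<Longrightarrow> N #> fst (\<Psi> g) i = N #> (b [^] i \<otimes> g \<otimes> inv (b [^] (i + \<chi> g)))"
  using congruent[of g] by (simp add: map_wreath_def shift_conj_def fun_eq_iff split: prod.splits)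

lemma K_subgroup: "subgroup K G"
  by (rule subgroupI) (auto intro: exI[of _ \<one>])

lemma e_hom: "e \<in> hom (G\<lparr>carrier := K\<rparr>) G"
proof (rule homI)
  fix x assume "x \<in> carrier (G\<lparr>carrier := K\<rparr>)"
  then show "e x \<in> carrier G" by (simp add: fst_Psi_closed)
next
  fix x y assume "x \<in> carrier (G\<lparr>carrier := K\<rparr>)" "y \<in> carrier (G\<lparr>carrier := K\<rparr>)"
  then have xy: "x \<in> carrier G" "\<chi> x = 0" "y \<in> carrier G" by auto
  have "\<Psi> (x \<otimes> y) = (fst (\<Psi> x), 0) \<otimes>\<^bsub>shift_wreath G\<^esub> (fst (\<Psi> y), \<chi> y)"
    using Psi_eq[OF xy(1)] Psi_eq[OF xy(3)] xy by simp
  then show "e (x \<otimes>\<^bsub>G\<lparr>carrier := K\<rparr>\<^esub> y) = e x \<otimes> e y"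
    by (simp add: mult_shift_wreath)
qed

lemma e_conj:
  assumes u: "u \<in> carrier G" and x: "x \<in> K"
  shows "e (u \<otimes> x \<otimes> inv u) = e u \<otimes> fst (\<Psi> x) (\<chi> u) \<otimes> inv (e u)"
proof -
  have xc: "x \<in> carrier G" "\<chi> x = 0" using x by auto
  have "\<Psi> (u \<otimes> x \<otimes> inv u) = \<Psi> u \<otimes>\<^bsub>shift_wreath G\<^esub> \<Psi> x \<otimes>\<^bsub>shift_wreath G\<^esub> inv\<^bsub>shift_wreath G\<^esub> \<Psi> u"
    using u xc(1) by simp
  also have "\<dots> = (fst (\<Psi> u), \<chi> u) \<otimes>\<^bsub>shift_wreath G\<^esub> (fst (\<Psi> x), 0)
      \<otimes>\<^bsub>shift_wreath G\<^esub> inv\<^bsub>shift_wreath G\<^esub> (fst (\<Psi> u), \<chi> u)"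
    using Psi_eq[OF u] Psi_eq[OF xc(1)] xc(2) by simp
  finally show ?thesis
    using fst_Psi_closed[OF u] by (simp add: mult_shift_wreath inv_shift_wreath)
qed

lemma A_in_K:
  assumes "x \<in> A"
  shows "x \<in> K"
proof -
  have "x \<in> carrier G" using A assms by blast
  then show ?thesis using trivial[OF assms] Psi_eq[of x] by (simp add: one_shift_wreath)
qed

lemma conj_K: "u \<in> carrier G \<Longrightarrow> x \<in> K \<Longrightarrow> u \<otimes> x \<otimes> inv u \<in> K"
  by simp

lemma N_subset_K: "N \<subseteq> K"
  by (rule normal_closure_least[OF A K_subgroup]) (intro conj_K A_in_K)

text \<open>A conjugate of \<open>a \<in> A\<close> by any \<open>u \<in> G\<close>, also outside \<open>K\<close>, is mapped to a conjugate of a coordinate of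
  the cocycle at \<open>a\<close>, and all coordinates are trivial there.\<close>

lemma e_trivial:
  assumes "x \<in> N"
  shows "e x = \<one>"
proof -
  interpret E: group_hom "G\<lparr>carrier := K\<rparr>" G e
    by (intro group_hom.intro group_hom_axioms.intro e_hom subgroup.subgroup_is_group[OF K_subgroup] is_group)
  have "subgroup (kernel (G\<lparr>carrier := K\<rparr>) G e) G"
    using incl_subgroup[OF K_subgroup E.subgroup_kernel] .
  moreover have "g \<otimes> a \<otimes> inv g \<in> kernel (G\<lparr>carrier := K\<rparr>) G e" if g: "g \<in> carrier G" and a: "a \<in> A" for g a
  proof -
    have "e (g \<otimes> a \<otimes> inv g) = \<one>"
      using e_conj[OF g A_in_K[OF a]] trivial[OF a] fst_Psi_closed[OF g] by (simp add: one_shift_wreath)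
    then show ?thesis using conj_K[OF g A_in_K[OF a]] by (simp add: kernel_def)
  qed
  ultimately have "N \<subseteq> kernel (G\<lparr>carrier := K\<rparr>) G e"
    by (intro normal_closure_least[OF A])
  then show ?thesis using assms by (auto simp: kernel_def)
qed

text \<open>Let \<open>y = u x u\<^sup>-\<^sup>1\<close> be a conjugate of an element on which the cocycle is not deformed. The
  deformation changes only the contribution of \<open>u\<close>, and this by some \<open>n \<in> N\<close>, so that
  \<open>e y = n y n\<^sup>-\<^sup>1\<close>. Hence \<open>y\<^sup>-\<^sup>1 e y\<close> is the commutator \<open>[y, n\<^sup>-\<^sup>1]\<close> of an element of the normal closure
  of \<open>B\<close> with one of \<open>N\<close>.\<close>

lemma e_congruent:
  assumes B: "B \<subseteq> K" and PsiB: "\<And>x. x \<in> B \<Longrightarrow> \<Psi> x = shift_conj G b \<chi> x"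
    and C: "C \<lhd> G" and comm: "\<And>x y. x \<in> normal_closure G B \<Longrightarrow> y \<in> N \<Longrightarrow> group_comm G x y \<in> C"
  shows "normal_closure G B \<subseteq> {x \<in> K. inv x \<otimes> e x \<in> C}"
proof (rule normal_closure_least[OF _ subgroup_hom_congruent[OF K_subgroup e_hom C]])
  show Bc: "B \<subseteq> carrier G" using B by blast
  interpret N: normal N G by (rule normal_closure_normal[OF A])
  fix u x assume u: "u \<in> carrier G" and x: "x \<in> B"
  have xK: "x \<in> K" "x \<in> carrier G" "\<chi> x = 0" using x B by auto
  let ?y = "u \<otimes> x \<otimes> inv u"
  define c where "c = u \<otimes> inv (b [^] \<chi> u)"
  have c: "c \<in> carrier G" "e u \<in> carrier G" using u b fst_Psi_closed by (simp_all add: c_def)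
  define n where "n = e u \<otimes> inv c"
  have "N #> e u = N #> c" using fst_Psi_coset[OF u, of 0] u b by (simp add: c_def)
  then have "inv c \<otimes> e u \<in> N"
    using rcoset_eq_iff[OF normal_closure_normal[OF A] c] by metis
  then have "c \<otimes> (inv c \<otimes> e u) \<otimes> inv c \<in> N"
    by (rule N.inv_op_closed2[OF c(1)])
  then have n: "n \<in> N" using c by (simp add: n_def group_word_simps)
  have "e u = n \<otimes> c" using c by (simp add: n_def group_word_simps)
  then have "e ?y = (n \<otimes> c) \<otimes> (b [^] \<chi> u \<otimes> x \<otimes> inv (b [^] \<chi> u)) \<otimes> inv (n \<otimes> c)"
    using e_conj[OF u xK(1)] PsiB[OF x] xK(3) by (simp add: shift_conj_def)
  also have "\<dots> = n \<otimes> ?y \<otimes> inv n"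
    using n u b xK(2) by (simp add: c_def group_word_simps)
  finally have "inv ?y \<otimes> e ?y = group_comm G ?y (inv n)"
    using n u xK(2) by (simp add: group_comm_def group_word_simps)
  moreover have "?y \<in> normal_closure G B"
    using normal.inv_op_closed2[OF normal_closure_normal[OF Bc] u] subset_normal_closure x by blast
  ultimately have "inv ?y \<otimes> e ?y \<in> C" using comm n by simp
  then show "?y \<in> {x \<in> K. inv x \<otimes> e x \<in> C}" using conj_K[OF u xK(1)] by blast
qed

end

section \<open>Presented groups\<close>

definition word_eval :: "('b, 'c) monoid_scheme \<Rightarrow> ('a \<Rightarrow> 'b) \<Rightarrow> 'a word \<Rightarrow> 'b" where
  "word_eval H f w =
     foldr (\<lambda>(x, b) z. (if b then f x else inv\<^bsub>H\<^esub> f x) \<otimes>\<^bsub>H\<^esub> z) w \<one>\<^bsub>H\<^esub>"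

lemma word_eval_Nil [simp]: "word_eval H f [] = \<one>\<^bsub>H\<^esub>"
  by (simp add: word_eval_def)

lemma word_eval_Cons [simp]:
  "word_eval H f ((x, b) # w) = (if b then f x else inv\<^bsub>H\<^esub> f x) \<otimes>\<^bsub>H\<^esub> word_eval H f w"
  by (simp add: word_eval_def)

lemma words_Cons [simp]: "(x, b) # w \<in> words S \<longleftrightarrow> x \<in> S \<and> w \<in> words S"
  by (auto simp: words_def)

lemma words_induct [consumes 1, case_names Nil Cons]:
  assumes "w \<in> words S" "Q []" "\<And>x b w. x \<in> S \<Longrightarrow> w \<in> words S \<Longrightarrow> Q w \<Longrightarrow> Q ((x, b) # w)"
  shows "Q w"
  using assms(1)
proof (induction w)
  case (Cons a w)
  then show ?case using assms(3) by (cases a) auto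
qed (rule assms(2))

lemma word_eval_cong:
  assumes "w \<in> words S" "\<And>x. x \<in> S \<Longrightarrow> f x = g x"
  shows "word_eval H f w = word_eval H g w"
  using assms(1) by (induction rule: words_induct) (auto simp: assms(2))

context group
begin

lemma word_eval_closed:
  assumes "w \<in> words S" "f \<in> S \<rightarrow> carrier G"
  shows "word_eval G f w \<in> carrier G"
  using assms(1) by (induction rule: words_induct) (use assms(2) in auto)

lemma word_eval_append:
  assumes "u \<in> words S" "v \<in> words S" "f \<in> S \<rightarrow> carrier G"
  shows "word_eval G f (u @ v) = word_eval G f u \<otimes> word_eval G f v"
  using assms(1)
proof (induction rule: words_induct)
  case Nil
  then show ?case using word_eval_closed[OF assms(2,3)] by simp
next
  case (Cons x b w)
  then have "f x \<in> carrier G" "word_eval G f w \<in> carrier G" "word_eval G f v \<in> carrier G"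
    using word_eval_closed[OF _ assms(3)] assms(2,3) by auto
  then show ?case using Cons by (simp add: m_assoc)
qed

lemma word_eval_trivial:
  assumes "w \<in> words S" "\<And>x. x \<in> S \<Longrightarrow> f x = \<one>"
  shows "word_eval G f w = \<one>"
  using assms(1) by (induction rule: words_induct) (auto simp: assms(2))

lemma word_eval_free_rel:
  assumes f: "f \<in> S \<rightarrow> carrier G" and "(u, v) \<in> free_rel S"
  shows "word_eval G f u = word_eval G f v"
  using assms(2)
proof (induction rule: free_rel.induct)
  case (free_cancel u v x b)
  have "word_eval G f ([(x, b), (x, \<not> b)] @ v) = word_eval G f v"
    using free_cancel funcset_mem[OF f, of x] word_eval_closed[OF _ f, of v]
    by (auto simp: group_word_simps)
  then show ?case
    using free_cancel f by (simp add: word_eval_append[OF _ _ f])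
qed auto

end

lemma (in group_hom) hom_word_eval:
  assumes "w \<in> words S" "f \<in> S \<rightarrow> carrier G"
  shows "h (word_eval G f w) = word_eval H (\<lambda>x. h (f x)) w"
  using assms(1)
proof (induction rule: words_induct)
  case (Cons x b w)
  then have "f x \<in> carrier G" "word_eval G f w \<in> carrier G"
    using G.word_eval_closed[OF _ assms(2)] assms(2) by auto
  then show ?case using Cons by simp
qed simp

lemma word_class_in_carrier: "w \<in> words S \<Longrightarrow> word_class S w \<in> carrier (free_group S)"
  by (simp add: carrier_free_group)

lemma word_eval_free_group:
  assumes "w \<in> words S"
  shows "word_eval (free_group S) (\<lambda>x. word_class S [(x, True)]) w = word_class S w"
  using assms
proof (induction rule: words_induct)
  case Nil
  then show ?case by (simp add: one_free_group)
next
  case (Cons x b w)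
  interpret F: group "free_group S" by (rule group_free_group)
  have "word_class S [(x, False)] \<otimes>\<^bsub>free_group S\<^esub> word_class S [(x, True)] = \<one>\<^bsub>free_group S\<^esub>"
    using Cons free_cancel[of "[]" S "[]" x False] by (simp add: mult_free_group one_free_group word_class_eq_iff)
  then have "inv\<^bsub>free_group S\<^esub> word_class S [(x, True)] = word_class S [(x, False)]"
    using Cons by (intro F.inv_equality word_class_in_carrier) auto
  then show ?case using Cons by (simp add: mult_free_group)
qed

lemma free_group_universal:
  assumes "group H" and f: "f \<in> S \<rightarrow> carrier H"
  obtains \<phi> where "\<phi> \<in> hom (free_group S) H" "\<And>w. w \<in> words S \<Longrightarrow> \<phi> (word_class S w) = word_eval H f w"
proof
  interpret H: group H by fact
  let ?phi = "\<lambda>U. the_elem (word_eval H f ` U)"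
  show *: "?phi (word_class S w) = word_eval H f w" if "w \<in> words S" for w
  proof -
    have "word_eval H f ` word_class S w = {word_eval H f w}"
    proof (intro equalityI subsetI)
      fix z assume "z \<in> word_eval H f ` word_class S w"
      then obtain v where v: "z = word_eval H f v" "(w, v) \<in> free_rel S"
        by (auto simp: word_class_def)
      show "z \<in> {word_eval H f w}" using H.word_eval_free_rel[OF f v(2)] v(1) by simp
    next
      fix z assume "z \<in> {word_eval H f w}"
      then show "z \<in> word_eval H f ` word_class S w"
        using free_refl[OF that] by (auto simp: word_class_def)
    qed
    then show ?thesis by simp
  qed
  show "?phi \<in> hom (free_group S) H"
  proof (rule homI)
    fix U assume "U \<in> carrier (free_group S)"
    then show "?phi U \<in> carrier H" using * H.word_eval_closed[OF _ f] by (auto simp: carrier_free_group)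
  next
    fix U V assume "U \<in> carrier (free_group S)" "V \<in> carrier (free_group S)"
    then obtain u v where "U = word_class S u" "u \<in> words S" "V = word_class S v" "v \<in> words S"
      by (auto simp: carrier_free_group)
    then show "?phi (U \<otimes>\<^bsub>free_group S\<^esub> V) = ?phi U \<otimes>\<^bsub>H\<^esub> ?phi V"
      using H.word_eval_append[OF _ _ f] by (simp add: mult_free_group *)
  qed
qed

locale presentation =
  fixes S :: "'a set" and E :: "('a word \<times> 'a word) set"
  assumes E_words: "(u, v) \<in> E \<Longrightarrow> u \<in> words S \<and> v \<in> words S"
begin

abbreviation Gp where "Gp \<equiv> presented_group (S, E)"
abbreviation gen where "gen \<equiv> presented_gen (S, E)"
abbreviation Rel where "Rel \<equiv> normal_closure (free_group S) (relators (S, E))"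

sublocale F: group "free_group S" by (rule group_free_group)

sublocale Gp: group Gp using E_words by (rule group_presented_group)

lemma relators_subset: "relators (S, E) \<subseteq> carrier (free_group S)"
  using E_words by (rule relators_carrier)

lemma Rel_normal: "Rel \<lhd> free_group S"
  using relators_subset by (rule F.normal_closure_normal)

lemma gen_closed: "gen \<in> S \<rightarrow> carrier Gp"
  by (simp add: presented_gen_carrier)

lemma Gp_eq: "Gp = free_group S Mod Rel"
  by (simp add: presented_group_def)

lemma word_eval_gen:
  assumes "w \<in> words S"
  shows "word_eval Gp gen w = Rel #>\<^bsub>free_group S\<^esub> word_class S w"
proof -
  interpret C: group_hom "free_group S" Gp "\<lambda>U. Rel #>\<^bsub>free_group S\<^esub> U"
    unfolding Gp_eq by (rule normal.coset_group_hom[OF Rel_normal])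
  have "(\<lambda>x. word_class S [(x, True)]) \<in> S \<rightarrow> carrier (free_group S)"
    by (simp add: word_class_in_carrier)
  from C.hom_word_eval[OF assms this] show ?thesis
    by (simp add: word_eval_free_group[OF assms] presented_gen_def[abs_def])
qed

lemma carrier_Gp: "carrier Gp = word_eval Gp gen ` words S"
proof -
  have "carrier Gp = (\<lambda>w. Rel #>\<^bsub>free_group S\<^esub> word_class S w) ` words S"
    by (auto simp: Gp_eq carrier_FactGroup carrier_free_group)
  then show ?thesis by (simp add: word_eval_gen cong: image_cong)
qed

lemma relation_holds:
  assumes "(u, v) \<in> E"
  shows "word_eval Gp gen u = word_eval Gp gen v"
proof -
  have uv: "u \<in> words S" "v \<in> words S" using E_words assms by auto
  interpret C: group_hom "free_group S" Gp "\<lambda>U. Rel #>\<^bsub>free_group S\<^esub> U"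
    unfolding Gp_eq by (rule normal.coset_group_hom[OF Rel_normal])
  let ?r = "word_class S u \<otimes>\<^bsub>free_group S\<^esub> inv\<^bsub>free_group S\<^esub> word_class S v"
  have "?r \<in> relators (S, E)" using assms by (auto simp: relators_def)
  then have "?r \<in> Rel" using F.subset_normal_closure by blast
  then have "Rel #>\<^bsub>free_group S\<^esub> ?r = Rel"
    using subgroup.rcos_const[OF normal_imp_subgroup[OF Rel_normal]] F.is_group by blast
  also have "\<dots> = \<one>\<^bsub>Gp\<^esub>" by (simp add: Gp_eq)
  finally have "word_eval Gp gen u \<otimes>\<^bsub>Gp\<^esub> inv\<^bsub>Gp\<^esub> word_eval Gp gen v = \<one>\<^bsub>Gp\<^esub>"
    using uv by (simp add: word_eval_gen word_class_in_carrier)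
  then have "inv\<^bsub>Gp\<^esub> (inv\<^bsub>Gp\<^esub> word_eval Gp gen v) = word_eval Gp gen u"
    using Gp.word_eval_closed[OF _ gen_closed] uv by (intro Gp.inv_equality) auto
  then show ?thesis
    using Gp.inv_inv[OF Gp.word_eval_closed[OF uv(2) gen_closed]] by argo
qed

lemma universal:
  assumes H: "group H" and f: "f \<in> S \<rightarrow> carrier H"
    and rel: "\<And>u v. (u, v) \<in> E \<Longrightarrow> word_eval H f u = word_eval H f v"
  obtains \<phi> where "\<phi> \<in> hom Gp H" "\<And>x. x \<in> S \<Longrightarrow> \<phi> (gen x) = f x"
proof -
  interpret H: group H by fact
  obtain \<phi> where phi: "\<phi> \<in> hom (free_group S) H" "\<And>w. w \<in> words S \<Longrightarrow> \<phi> (word_class S w) = word_eval H f w"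
    using free_group_universal[OF H f] by blast
  interpret phi: group_hom "free_group S" H \<phi>
    by (intro group_hom.intro group_hom_axioms.intro phi(1) F.is_group H)
  have "relators (S, E) \<subseteq> kernel (free_group S) H \<phi>"
  proof
    fix r assume "r \<in> relators (S, E)"
    then obtain u v where r: "r = word_class S u \<otimes>\<^bsub>free_group S\<^esub> inv\<^bsub>free_group S\<^esub> word_class S v" "(u, v) \<in> E"
      by (auto simp: relators_def)
    have uv: "u \<in> words S" "v \<in> words S" using E_words r(2) by auto
    then have "\<phi> r = \<one>\<^bsub>H\<^esub>"
      using r rel[OF r(2)] H.word_eval_closed[OF uv(2) f] by (simp add: word_class_in_carrier phi(2))
    then show "r \<in> kernel (free_group S) H \<phi>"
      using r(1) uv by (simp add: kernel_def word_class_in_carrier)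
  qed
  then have "Rel \<subseteq> kernel (free_group S) H \<phi>"
    using phi.normal_kernel unfolding normal_closure_def by blast
  then obtain \<psi> where psi: "\<psi> \<in> hom (free_group S Mod Rel) H"
    "\<And>U. U \<in> carrier (free_group S) \<Longrightarrow> \<psi> (Rel #>\<^bsub>free_group S\<^esub> U) = \<phi> U"
    using phi.FactGroup_universal_kernel[OF Rel_normal] by blast
  show ?thesis
  proof
    show "\<psi> \<in> hom Gp H" using psi(1) by (simp add: Gp_eq)
    show "\<psi> (gen x) = f x" if "x \<in> S" for x
      using that funcset_mem[OF f that] by (simp add: presented_gen_def psi(2) word_class_in_carrier phi(2))
  qed
qed

lemma hom_eqI:
  assumes H: "group H" and phi: "\<phi> \<in> hom Gp H" and psi: "\<psi> \<in> hom Gp H"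
    and eq: "\<And>x. x \<in> S \<Longrightarrow> \<phi> (gen x) = \<psi> (gen x)" and g: "g \<in> carrier Gp"
  shows "\<phi> g = \<psi> g"
proof -
  interpret phi: group_hom Gp H \<phi>
    by (intro group_hom.intro group_hom_axioms.intro phi Gp.is_group H)
  interpret psi: group_hom Gp H \<psi>
    by (intro group_hom.intro group_hom_axioms.intro psi Gp.is_group H)
  obtain w where w: "g = word_eval Gp gen w" "w \<in> words S" using g carrier_Gp by auto
  have "\<phi> g = word_eval H (\<lambda>x. \<phi> (gen x)) w"
    unfolding w(1) by (rule phi.hom_word_eval[OF w(2) gen_closed])
  also have "\<dots> = word_eval H (\<lambda>x. \<psi> (gen x)) w" using w(2) eq by (rule word_eval_cong)
  also have "\<dots> = \<psi> g"
    unfolding w(1) by (rule psi.hom_word_eval[OF w(2) gen_closed, symmetric])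
  finally show ?thesis .
qed

end

section \<open>Solving surface relations along the integers\<close>

text \<open>A recursion that can be run in both directions has a solution through any initial value. It is
  essential that the integers contain no cycle: a shift of finite order would impose a closing
  condition.\<close>

lemma int_sequence_exists:
  fixes Q :: "int \<Rightarrow> 'a \<Rightarrow> bool" and L :: "int \<Rightarrow> 'a \<Rightarrow> 'a \<Rightarrow> bool"
  assumes start: "Q 0 c"
    and up: "\<And>k z. Q k z \<Longrightarrow> \<exists>z'. Q (k + 1) z' \<and> L k z z'"
    and down: "\<And>k z'. Q (k + 1) z' \<Longrightarrow> \<exists>z. Q k z \<and> L k z z'"
  obtains s where "\<And>k. Q k (s k)" "\<And>k. L k (s k) (s (k + 1))"
proof -
  have "\<exists>f. \<forall>n. (Q (int n) (f n) \<and> (n = 0 \<longrightarrow> f n = c)) \<and> L (int n) (f n) (f (Suc n))"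
  proof (rule dependent_nat_choice)
    show "\<exists>x. Q (int 0) x \<and> (0 = (0::nat) \<longrightarrow> x = c)" using start by simp
    show "\<exists>y. (Q (int (Suc n)) y \<and> (Suc n = 0 \<longrightarrow> y = c)) \<and> L (int n) x y"
      if "Q (int n) x \<and> (n = 0 \<longrightarrow> x = c)" for x n
      using up[of "int n" x] that by (auto simp: add.commute)
  qed
  then obtain f where f: "\<And>n. Q (int n) (f n)" "f 0 = c" "\<And>n. L (int n) (f n) (f (Suc n))"
    by auto
  have "\<exists>g. \<forall>n. (Q (- int n) (g n) \<and> (n = 0 \<longrightarrow> g n = c)) \<and> L (- int n - 1) (g (Suc n)) (g n)"
  proof (rule dependent_nat_choice)
    show "\<exists>x. Q (- int 0) x \<and> (0 = (0::nat) \<longrightarrow> x = c)" using start by simp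
    show "\<exists>y. (Q (- int (Suc n)) y \<and> (Suc n = 0 \<longrightarrow> y = c)) \<and> L (- int n - 1) y x"
      if "Q (- int n) x \<and> (n = 0 \<longrightarrow> x = c)" for x n
    proof -
      have eq: "- int (Suc n) = - int n - 1" by simp
      show ?thesis unfolding eq using down[of "- int n - 1" x] that by auto
    qed
  qed
  then obtain g where g: "\<And>n. Q (- int n) (g n)" "g 0 = c" "\<And>n. L (- int n - 1) (g (Suc n)) (g n)"
    by auto
  define s where "s k = (if k \<ge> 0 then f (nat k) else g (nat (- k)))" for k
  show thesis
  proof
    fix k :: int
    show "Q k (s k)" using f(1)[of "nat k"] g(1)[of "nat (- k)"] by (cases "k \<ge> 0") (simp_all add: s_def)
    show "L k (s k) (s (k + 1))"
    proof (cases "k \<ge> 0")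
      case True
      then show ?thesis using f(3)[of "nat k"] by (simp add: s_def nat_add_distrib)
    next
      case False
      define n where "n = nat (- k - 1)"
      have k: "k = - int n - 1" using False by (simp add: n_def)
      have "s k = g (Suc n)" using k by (simp add: s_def nat_add_distrib)
      moreover have "s (k + 1) = g n" using k f(2) g(2) by (cases n) (simp_all add: s_def nat_add_distrib)
      ultimately show ?thesis using g(3)[of n] k by simp
    qed
  qed
qed

abbreviation shift_unit :: "('a, 'b) monoid_scheme \<Rightarrow> (int \<Rightarrow> 'a) \<times> int" where
  "shift_unit G \<equiv> (\<lambda>_. \<one>\<^bsub>G\<^esub>, 1)"

lemma (in group) group_comm_shift_unit:
  assumes "\<And>i. s i \<in> carrier G"
  shows "group_comm (shift_wreath G) (s, 0) (shift_unit G) = (\<lambda>i. inv (s i) \<otimes> s (i - 1), 0)"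
  using assms by (simp add: group_comm_def mult_shift_wreath inv_shift_wreath)

lemma (in group) Klein_word_shift_unit:
  assumes "\<And>i. s i \<in> carrier G"
  shows "shift_unit G \<otimes>\<^bsub>shift_wreath G\<^esub> (s, 0) \<otimes>\<^bsub>shift_wreath G\<^esub>
      inv\<^bsub>shift_wreath G\<^esub> shift_unit G \<otimes>\<^bsub>shift_wreath G\<^esub> (s, 0) = (\<lambda>i. s (i + 1) \<otimes> s i, 0)"
  using assms by (simp add: mult_shift_wreath inv_shift_wreath)

context group_hom
begin

text \<open>In coordinates \<open>[(s, 0), shift_unit G] = (c, 0)\<close> reads \<open>s (k - 1) = s k \<cdot> c k\<close>, which determines \<open>s\<close>
  from \<open>s 0\<close>. The images under \<open>h\<close> of \<open>s\<close> and of the given solution \<open>s0\<close> obey the same recursion, so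
  they agree once they agree at \<open>0\<close>.\<close>

lemma lift_group_comm_shift_unit:
  assumes s0: "\<And>i. s0 i \<in> carrier G" and v: "v \<in> carrier (shift_wreath G)"
    and eq: "map_wreath h v = map_wreath h (group_comm (shift_wreath G) (s0, 0) (shift_unit G))"
  obtains s where "\<And>i. s i \<in> carrier G" "\<And>i. h (s i) = h (s0 i)"
    "group_comm (shift_wreath G) (s, 0) (shift_unit G) = v"
proof -
  obtain c where c: "v = (c, 0)" "\<And>i. c i \<in> carrier G" "\<And>i. h (c i) = inv\<^bsub>H\<^esub> h (s0 i) \<otimes>\<^bsub>H\<^esub> h (s0 (i - 1))"
    using v eq s0 by (cases v) (auto simp: G.group_comm_shift_unit carrier_shift_wreath fun_eq_iff)
  obtain s where s: "\<And>k. s k \<in> carrier G \<and> h (s k) = h (s0 k)" "\<And>k. s k = s (k + 1) \<otimes> c (k + 1)"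
  proof (rule int_sequence_exists[where Q = "\<lambda>k z. z \<in> carrier G \<and> h z = h (s0 k)"
        and L = "\<lambda>k z z'. z = z' \<otimes> c (k + 1)"])
    show "s0 0 \<in> carrier G \<and> h (s0 0) = h (s0 0)" using s0 by simp
  next
    fix k z assume "z \<in> carrier G \<and> h z = h (s0 k)"
    then show "\<exists>z'. (z' \<in> carrier G \<and> h z' = h (s0 (k + 1))) \<and> z = z' \<otimes> c (k + 1)"
      using c(2,3) s0
      by (intro exI[of _ "z \<otimes> inv (c (k + 1))"]) (simp add: H.group_word_simps G.group_word_simps)
  next
    fix k z' assume "z' \<in> carrier G \<and> h z' = h (s0 (k + 1))"
    then show "\<exists>z. (z \<in> carrier G \<and> h z = h (s0 k)) \<and> z = z' \<otimes> c (k + 1)"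
      using c(2,3) s0 by (simp add: H.group_word_simps)
  qed blast
  have "inv (s i) \<otimes> s (i - 1) = c i" for i
    using s(1)[of i] s(2)[of "i - 1"] c(2) by (simp add: G.group_word_simps)
  then show ?thesis
    using s(1) c(1) by (intro that[of s]) (simp_all add: G.group_comm_shift_unit)
qed

text \<open>As before, with the recursion \<open>s (k + 1) \<cdot> s k = c k\<close>.\<close>

lemma lift_Klein_word_shift_unit:
  assumes s0: "\<And>i. s0 i \<in> carrier G" and v: "v \<in> carrier (shift_wreath G)"
    and eq: "map_wreath h v = map_wreath h (shift_unit G \<otimes>\<^bsub>shift_wreath G\<^esub> (s0, 0) \<otimes>\<^bsub>shift_wreath G\<^esub>
      inv\<^bsub>shift_wreath G\<^esub> shift_unit G \<otimes>\<^bsub>shift_wreath G\<^esub> (s0, 0))"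
  obtains s where "\<And>i. s i \<in> carrier G" "\<And>i. h (s i) = h (s0 i)"
    "shift_unit G \<otimes>\<^bsub>shift_wreath G\<^esub> (s, 0) \<otimes>\<^bsub>shift_wreath G\<^esub>
      inv\<^bsub>shift_wreath G\<^esub> shift_unit G \<otimes>\<^bsub>shift_wreath G\<^esub> (s, 0) = v"
proof -
  obtain c where c: "v = (c, 0)" "\<And>i. c i \<in> carrier G" "\<And>i. h (c i) = h (s0 (i + 1)) \<otimes>\<^bsub>H\<^esub> h (s0 i)"
    using v eq s0 by (cases v) (auto simp: G.Klein_word_shift_unit carrier_shift_wreath fun_eq_iff)
  obtain s where s: "\<And>k. s k \<in> carrier G \<and> h (s k) = h (s0 k)" "\<And>k. s (k + 1) \<otimes> s k = c k"
  proof (rule int_sequence_exists[where Q = "\<lambda>k z. z \<in> carrier G \<and> h z = h (s0 k)"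
        and L = "\<lambda>k z z'. z' \<otimes> z = c k"])
    show "s0 0 \<in> carrier G \<and> h (s0 0) = h (s0 0)" using s0 by simp
  next
    fix k z assume "z \<in> carrier G \<and> h z = h (s0 k)"
    then show "\<exists>z'. (z' \<in> carrier G \<and> h z' = h (s0 (k + 1))) \<and> z' \<otimes> z = c k"
      using c(2,3) s0
      by (intro exI[of _ "c k \<otimes> inv z"]) (simp add: H.group_word_simps G.group_word_simps)
  next
    fix k z' assume "z' \<in> carrier G \<and> h z' = h (s0 (k + 1))"
    then show "\<exists>z. (z \<in> carrier G \<and> h z = h (s0 k)) \<and> z' \<otimes> z = c k"
      using c(2,3) s0
      by (intro exI[of _ "inv z' \<otimes> c k"]) (simp add: H.group_word_simps G.group_word_simps)
  qed blast
  show ?thesis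
    using s c(1) by (intro that[of s]) (simp_all add: G.Klein_word_shift_unit)
qed

end

section \<open>Deformations given on the generators of a presentation\<close>

lemma (in group) map_wreath_coset_hom:
  assumes "M \<lhd> G"
  shows "group_hom (shift_wreath G) (shift_wreath (G Mod M)) (map_wreath (\<lambda>x. M #> x))"
proof -
  interpret M: normal M G by fact
  interpret Q: group "G Mod M" by (rule M.factorgroup_is_group)
  show ?thesis
    by (intro group_hom.intro group_hom_axioms.intro group_shift_wreath Q.group_shift_wreath
        map_wreath_hom M.r_coset_hom_Mod)
qed

context presentation
begin

text \<open>Values on the generators that extend, by the universal property, to a cocycle which kills \<open>A\<close>, is
  tautological on \<open>Z - A\<close>, and is tautological modulo the normal closure of \<open>A\<close> on the remaining
  generators. There the values have to be adjusted so that the relations stay valid.\<close>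

definition deformation_on ::
  "'a word set set \<Rightarrow> ('a word set set \<Rightarrow> int) \<Rightarrow> 'a set \<Rightarrow> 'a set \<Rightarrow>
    ('a \<Rightarrow> (int \<Rightarrow> 'a word set set) \<times> int) \<Rightarrow> bool" where
  "deformation_on b \<chi> Z A f \<longleftrightarrow> f \<in> S \<rightarrow> carrier (shift_wreath Gp) \<and>
     (\<forall>s\<in>S. map_wreath (r_coset Gp (normal_closure Gp (gen ` A))) (f s) =
            map_wreath (r_coset Gp (normal_closure Gp (gen ` A))) (shift_conj Gp b \<chi> (gen s))) \<and>
     (\<forall>s\<in>A. f s = one (shift_wreath Gp)) \<and>
     (\<forall>s\<in>Z - A. f s = shift_conj Gp b \<chi> (gen s)) \<and>
     (\<forall>(u, v)\<in>E. word_eval (shift_wreath Gp) f u = word_eval (shift_wreath Gp) f v)"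

text \<open>The homomorphism \<open>\<chi>\<close> has to vanish on all of \<open>Z\<close>, so that the retraction for one part of \<open>Z\<close> is
  defined on the normal closures of the other parts; one choice of \<open>b\<close> and \<open>\<chi>\<close> then serves all
  parts.\<close>

definition deformable :: "'a set \<Rightarrow> bool" where
  "deformable Z \<longleftrightarrow> Z \<subseteq> S \<and> (\<exists>b\<in>carrier Gp. \<exists>\<chi>\<in>hom Gp integer_group.
     (\<forall>x\<in>Z. \<chi> (gen x) = 0) \<and> (\<forall>A\<subseteq>Z. \<exists>f. deformation_on b \<chi> Z A f))"

lemma gen_subset: "Z \<subseteq> S \<Longrightarrow> gen ` Z \<subseteq> carrier Gp"
  using gen_closed by auto

lemma deformation_hom:
  assumes b: "b \<in> carrier Gp" and chi: "\<chi> \<in> hom Gp integer_group" and A: "A \<subseteq> S"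
    and f: "deformation_on b \<chi> Z A f"
  obtains \<Psi> where "shift_deformation Gp b \<chi> (gen ` A) \<Psi>" "\<And>s. s \<in> S \<Longrightarrow> \<Psi> (gen s) = f s"
proof -
  let ?W = "shift_wreath Gp"
  let ?N = "normal_closure Gp (gen ` A)"
  let ?q = "map_wreath (\<lambda>x. ?N #>\<^bsub>Gp\<^esub> x)"
  have N: "?N \<lhd> Gp" by (intro Gp.normal_closure_normal gen_subset A)
  interpret q: group_hom ?W "shift_wreath (Gp Mod ?N)" ?q by (rule Gp.map_wreath_coset_hom[OF N])
  obtain \<Psi> where Psi: "\<Psi> \<in> hom Gp ?W" "\<And>s. s \<in> S \<Longrightarrow> \<Psi> (gen s) = f s"
    using universal[OF Gp.group_shift_wreath, of f] f unfolding deformation_on_def by blast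
  have c0: "shift_conj Gp b \<chi> \<in> hom Gp ?W" using b chi by (rule Gp.shift_conj_hom)
  show ?thesis
  proof
    show "shift_deformation Gp b \<chi> (gen ` A) \<Psi>"
    proof
      fix g assume g: "g \<in> carrier Gp"
      have "(?q \<circ> \<Psi>) g = (?q \<circ> shift_conj Gp b \<chi>) g"
      proof (rule hom_eqI[OF q.H.is_group])
        show "?q \<circ> \<Psi> \<in> hom Gp (shift_wreath (Gp Mod ?N))"
          "?q \<circ> shift_conj Gp b \<chi> \<in> hom Gp (shift_wreath (Gp Mod ?N))"
          using hom_compose[OF Psi(1) q.homh] hom_compose[OF c0 q.homh] .
        show "(?q \<circ> \<Psi>) (gen s) = (?q \<circ> shift_conj Gp b \<chi>) (gen s)" if "s \<in> S" for s
          using f that Psi(2) by (simp add: deformation_on_def)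
      qed (rule g)
      then show "?q (\<Psi> g) = ?q (shift_conj Gp b \<chi> g)" by simp
    next
      fix x assume "x \<in> gen ` A"
      then show "\<Psi> x = \<one>\<^bsub>?W\<^esub>" using f A Psi(2) by (auto simp: deformation_on_def)
    qed (use b chi Psi(1) gen_subset[OF A] in auto)
  qed (rule Psi(2))
qed

text \<open>Coordinate \<open>0\<close> of the cocycle that kills \<open>P j\<close> is the retraction \<open>e j\<close> of
  \<open>Inter_subset_sym_comm\<close>; disjointness of the parts makes this cocycle tautological on all other
  \<open>P i\<close>.\<close>

theorem Inter_subset_sym_comm_of_deformable:
  assumes Z: "deformable Z" and P: "\<And>i. P i \<subseteq> Z" "\<And>i j. i \<noteq> j \<Longrightarrow> P i \<inter> P j = {}"
    and I: "finite I" "I \<noteq> {}"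
  shows "(\<Inter>i\<in>I. normal_closure Gp (gen ` P i)) \<subseteq> sym_comm Gp (\<lambda>i. normal_closure Gp (gen ` P i)) I"
proof -
  define R where "R i = normal_closure Gp (gen ` P i)" for i
  obtain b \<chi> where b: "b \<in> carrier Gp" and chi: "\<chi> \<in> hom Gp integer_group"
    and ZS: "Z \<subseteq> S" and chi0: "\<And>x. x \<in> Z \<Longrightarrow> \<chi> (gen x) = 0"
    and f: "\<And>A. A \<subseteq> Z \<Longrightarrow> \<exists>f. deformation_on b \<chi> Z A f"
    using Z unfolding deformable_def by blast
  have "\<exists>\<Psi>. shift_deformation Gp b \<chi> (gen ` P j) \<Psi> \<and>
      (\<forall>s\<in>Z - P j. \<Psi> (gen s) = shift_conj Gp b \<chi> (gen s))" for j
  proof -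
    obtain f where f: "deformation_on b \<chi> Z (P j) f" using f P(1) by blast
    have "P j \<subseteq> S" using P(1) ZS by blast
    then obtain \<Psi> where "shift_deformation Gp b \<chi> (gen ` P j) \<Psi>" "\<And>s. s \<in> S \<Longrightarrow> \<Psi> (gen s) = f s"
      using deformation_hom[OF b chi _ f] by blast
    moreover from this(2) have "\<Psi> (gen s) = shift_conj Gp b \<chi> (gen s)" if "s \<in> Z - P j" for s
      using that f ZS by (auto simp: deformation_on_def)
    ultimately show ?thesis by blast
  qed
  then obtain \<Psi> where Psi: "\<And>j. shift_deformation Gp b \<chi> (gen ` P j) (\<Psi> j)"
    "\<And>j s. s \<in> Z - P j \<Longrightarrow> \<Psi> j (gen s) = shift_conj Gp b \<chi> (gen s)"
    by metis
  interpret nf: normal_family Gp R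
  proof (intro normal_family.intro normal_family_axioms.intro Gp.is_group)
    show "R i \<lhd> Gp" for i
      unfolding R_def using P(1)[of i] ZS by (intro Gp.normal_closure_normal gen_subset) auto
  qed
  have "(\<Inter>i\<in>I. R i) \<subseteq> sym_comm Gp R I"
  proof (rule nf.Inter_subset_sym_comm[where K = "\<lambda>_. {g \<in> carrier Gp. \<chi> g = 0}"
        and e = "\<lambda>j g. fst (\<Psi> j g) 0", OF _ _ _ _ _ I])
    fix i j
    interpret D: shift_deformation Gp b \<chi> "gen ` P j" "\<Psi> j" by (rule Psi)
    interpret D': shift_deformation Gp b \<chi> "gen ` P i" "\<Psi> i" by (rule Psi)
    show "subgroup {g \<in> carrier Gp. \<chi> g = 0} Gp" by (rule D.K_subgroup)
    show "R i \<subseteq> {g \<in> carrier Gp. \<chi> g = 0}" unfolding R_def by (rule D'.N_subset_K)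
    show "(\<lambda>g. fst (\<Psi> j g) 0) \<in> hom (Gp\<lparr>carrier := {g \<in> carrier Gp. \<chi> g = 0}\<rparr>) Gp" by (rule D.e_hom)
    show "fst (\<Psi> j x) 0 = \<one>\<^bsub>Gp\<^esub>" if "x \<in> R j" for x
      using that unfolding R_def by (rule D.e_trivial)
    show "inv\<^bsub>Gp\<^esub> x \<otimes>\<^bsub>Gp\<^esub> fst (\<Psi> j x) 0 \<in> sym_comm Gp R {i, j}" if ij: "i \<noteq> j" and x: "x \<in> R i" for x
    proof -
      have "normal_closure Gp (gen ` P i) \<subseteq>
          {x \<in> {g \<in> carrier Gp. \<chi> g = 0}. inv\<^bsub>Gp\<^esub> x \<otimes>\<^bsub>Gp\<^esub> fst (\<Psi> j x) 0 \<in> sym_comm Gp R {i, j}}"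
      proof (rule D.e_congruent[OF _ _ nf.sym_comm_normal])
        show "gen ` P i \<subseteq> {g \<in> carrier Gp. \<chi> g = 0}" using D'.A_in_K by blast
        show "\<Psi> j x = shift_conj Gp b \<chi> x" if "x \<in> gen ` P i" for x
          using that P(1)[of i] P(2)[OF ij] Psi(2) by blast
        show "group_comm Gp x y \<in> sym_comm Gp R {i, j}"
          if "x \<in> normal_closure Gp (gen ` P i)" "y \<in> normal_closure Gp (gen ` P j)" for x y
          using nf.group_comm_sym_comm[of x "{i}" y j] nf.subset_sym_comm_singleton[of i] that ij
          by (auto simp: R_def insert_commute)
      qed
      then show ?thesis using x unfolding R_def by blast
    qed
  qed
  then show ?thesis unfolding R_def .
qed

end

text \<open>The first approximation \<open>base\<close> to a deformation trivialises the generators in \<open>A\<close> and changes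
  nothing else. It respects the relations only modulo the normal closure \<open>N\<close> of \<open>A\<close>; its value at one
  further generator will be adjusted within its class modulo \<open>N\<close> to repair this.\<close>

locale base_deformation = presentation S E for S :: "'a set" and E +
  fixes Z A :: "'a set" and b and \<chi>
  assumes Z: "Z \<subseteq> S" and A: "A \<subseteq> Z"
    and b: "b \<in> carrier Gp" and chi: "\<chi> \<in> hom Gp integer_group"
    and chi_Z: "\<And>x. x \<in> Z \<Longrightarrow> \<chi> (gen x) = 0"
begin

abbreviation W where "W \<equiv> shift_wreath Gp"
abbreviation N where "N \<equiv> normal_closure Gp (gen ` A)"
abbreviation q where "q \<equiv> map_wreath (\<lambda>x. N #>\<^bsub>Gp\<^esub> x)"
abbreviation \<Psi>0 where "\<Psi>0 \<equiv> shift_conj Gp b \<chi>"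

definition base where "base s = (if s \<in> A then \<one>\<^bsub>W\<^esub> else \<Psi>0 (gen s))"

lemma A_subset: "gen ` A \<subseteq> carrier Gp"
  using gen_subset Z A by blast

lemma N_normal: "N \<lhd> Gp"
  using A_subset by (rule Gp.normal_closure_normal)

sublocale coset: group_hom Gp "Gp Mod N" "\<lambda>x. N #>\<^bsub>Gp\<^esub> x"
  using N_normal by (rule normal.coset_group_hom)

sublocale q: group_hom W "shift_wreath (Gp Mod N)" q
  using N_normal by (rule Gp.map_wreath_coset_hom)

sublocale Psi0: group_hom Gp W \<Psi>0
  by (intro group_hom.intro group_hom_axioms.intro Gp.is_group Gp.group_shift_wreath
      Gp.shift_conj_hom b chi)

lemma gen_carrier: "s \<in> S \<Longrightarrow> gen s \<in> carrier Gp"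
  using gen_closed by blast

lemma base_closed: "base \<in> S \<rightarrow> carrier W"
  using gen_carrier by (auto simp: base_def)

lemma base_congruent:
  assumes "s \<in> S"
  shows "q (base s) = q (\<Psi>0 (gen s))"
proof (cases "s \<in> A")
  \<comment> \<open>All coordinates of the tautological cocycle at \<open>s \<in> A\<close> are conjugates of \<open>gen s\<close>, so they lie in \<open>N\<close>.\<close>
  case True
  interpret N: normal N Gp by (rule N_normal)
  have s: "gen s \<in> N" "\<chi> (gen s) = 0"
    using True A chi_Z Gp.subset_normal_closure[of "gen ` A"] by auto
  have "b [^]\<^bsub>Gp\<^esub> (i::int) \<otimes>\<^bsub>Gp\<^esub> gen s \<otimes>\<^bsub>Gp\<^esub> inv\<^bsub>Gp\<^esub> (b [^]\<^bsub>Gp\<^esub> i) \<in> N" for i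
    using N.inv_op_closed2 s b by simp
  then show ?thesis
    using True s N.rcos_const[OF Gp.is_group]
    by (simp add: base_def shift_conj_def one_shift_wreath)
qed (simp add: base_def)

lemma word_congruent:
  assumes "w \<in> words S" "f \<in> S \<rightarrow> carrier W" "\<And>s. s \<in> S \<Longrightarrow> q (f s) = q (\<Psi>0 (gen s))"
  shows "q (word_eval W f w) = q (\<Psi>0 (word_eval Gp gen w))"
proof -
  have "q (word_eval W f w) = word_eval (shift_wreath (Gp Mod N)) (\<lambda>s. q (f s)) w"
    using assms by (intro q.hom_word_eval)
  also have "\<dots> = word_eval (shift_wreath (Gp Mod N)) (\<lambda>s. q (\<Psi>0 (gen s))) w"
    using assms by (intro word_eval_cong)
  also have "\<dots> = q (word_eval W (\<lambda>s. \<Psi>0 (gen s)) w)"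
    using assms(1) gen_carrier by (intro q.hom_word_eval[symmetric]) auto
  also have "\<dots> = q (\<Psi>0 (word_eval Gp gen w))"
    using assms(1) gen_closed by (subst Psi0.hom_word_eval) auto
  finally show ?thesis .
qed

lemma quotient_congruent:
  assumes "u \<in> words S" "v \<in> words S"
  shows "q (word_eval W base v \<otimes>\<^bsub>W\<^esub> inv\<^bsub>W\<^esub> word_eval W base u) =
    q (\<Psi>0 (word_eval Gp gen v \<otimes>\<^bsub>Gp\<^esub> inv\<^bsub>Gp\<^esub> word_eval Gp gen u))"
  using q.G.word_eval_closed[OF assms(1) base_closed] q.G.word_eval_closed[OF assms(2) base_closed]
    Gp.word_eval_closed[OF assms(1) gen_closed] Gp.word_eval_closed[OF assms(2) gen_closed]
    word_congruent[OF assms(1) base_closed base_congruent] word_congruent[OF assms(2) base_closed base_congruent]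
  by simp

lemma deformation_on_update:
  assumes y: "y \<in> S - Z" and z: "z \<in> carrier W" "q z = q (\<Psi>0 (gen y))"
    and rel: "\<And>u v. (u, v) \<in> E \<Longrightarrow> word_eval W (base(y := z)) u = word_eval W (base(y := z)) v"
  shows "deformation_on b \<chi> Z A (base(y := z))"
  unfolding deformation_on_def
proof (intro conjI)
  show "base(y := z) \<in> S \<rightarrow> carrier W" using base_closed z by auto
  show "\<forall>s\<in>S. q ((base(y := z)) s) = q (\<Psi>0 (gen s))" using base_congruent z by simp
  show "\<forall>s\<in>A. (base(y := z)) s = \<one>\<^bsub>W\<^esub>" using A y by (auto simp: base_def)
  show "\<forall>s\<in>Z - A. (base(y := z)) s = \<Psi>0 (gen s)" using y by (auto simp: base_def)
  show "\<forall>(u, v)\<in>E. word_eval W (base(y := z)) u = word_eval W (base(y := z)) v" using rel by blast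
qed

lemma word_eval_update:
  "w \<in> words (S - {y}) \<Longrightarrow> word_eval W (base(y := z)) w = word_eval W base w"
  by (rule word_eval_cong[of w "S - {y}"]) auto

end

section \<open>Relations with a boundary letter or a handle\<close>

lemma words_mono: "S \<subseteq> T \<Longrightarrow> words S \<subseteq> words T"
  by (auto simp: words_def)

context presentation
begin

text \<open>The letter \<open>y\<close> occurs once, so the relation can be solved for it in any group. The constant \<open>\<chi> = 0\<close>
  is enough here: the retractions are then defined on the whole group, which is free on the
  generators other than \<open>y\<close>.\<close>

lemma deformable_boundary:
  assumes E: "E = {(u, (y, True) # v)}" and y: "y \<in> S - Z" and Z: "Z \<subseteq> S"
    and u: "u \<in> words (S - {y})" and v: "v \<in> words (S - {y})"
  shows "deformable Z"
proof -
  have inE: "(u, (y, True) # v) \<in> E" by (simp add: E)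
  let ?chi = "\<lambda>_. 0 :: int"
  have chi: "?chi \<in> hom Gp integer_group" by (simp add: hom_def)
  have "\<exists>f. deformation_on \<one>\<^bsub>Gp\<^esub> ?chi Z A f" if A: "A \<subseteq> Z" for A
  proof -
    interpret B: base_deformation S E Z A "\<one>\<^bsub>Gp\<^esub>" ?chi
      using Z A chi by unfold_locales auto
    have uS: "u \<in> words S" and vS: "v \<in> words S" using u v words_mono[of "S - {y}" S] by auto
    note evals = B.q.G.word_eval_closed[OF uS B.base_closed] B.q.G.word_eval_closed[OF vS B.base_closed]
      Gp.word_eval_closed[OF uS gen_closed] Gp.word_eval_closed[OF vS gen_closed] B.gen_carrier[of y]
    have "word_eval Gp gen u = gen y \<otimes>\<^bsub>Gp\<^esub> word_eval Gp gen v"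
      using relation_holds[OF inE] by simp
    then have gy: "word_eval Gp gen u \<otimes>\<^bsub>Gp\<^esub> inv\<^bsub>Gp\<^esub> word_eval Gp gen v = gen y"
      using evals y by (simp add: Gp.group_word_simps)
    define z where "z = word_eval B.W B.base u \<otimes>\<^bsub>B.W\<^esub> inv\<^bsub>B.W\<^esub> word_eval B.W B.base v"
    have z: "z \<in> carrier B.W" "B.q z = B.q (B.\<Psi>0 (gen y))"
      unfolding z_def using evals B.quotient_congruent[OF vS uS] gy by simp_all
    have "deformation_on \<one>\<^bsub>Gp\<^esub> ?chi Z A (B.base(y := z))"
    proof (rule B.deformation_on_update[OF y z])
      fix u' v' assume "(u', v') \<in> E"
      then have uv: "u' = u" "v' = (y, True) # v" using E by auto
      show "word_eval B.W (B.base(y := z)) u' = word_eval B.W (B.base(y := z)) v'"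
        unfolding uv word_eval_Cons B.word_eval_update[OF u] B.word_eval_update[OF v]
        using evals by (simp add: z_def B.q.G.group_word_simps)
    qed
    then show ?thesis by blast
  qed
  then show ?thesis
    unfolding deformable_def using chi Z
    by (intro conjI bexI[of _ "\<one>\<^bsub>Gp\<^esub>"] bexI[of _ ?chi]) auto
qed

text \<open>Let \<open>\<chi>\<close> count the letter \<open>c\<close> and let \<open>b\<close> be the generator \<open>c\<close>, which the tautological cocycle
  sends to the unit shift. The relation then prescribes the commutator of the value at \<open>a\<close> with the
  unit shift, and such an equation has a solution in the required class.\<close>

lemma deformable_handle:
  assumes E: "E = {([(a, False), (c, False), (a, True), (c, True)] @ u, v)}"
    and ac: "a \<in> S - Z" "c \<in> S - Z" "a \<noteq> c" and Z: "Z \<subseteq> S"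
    and u: "u \<in> words (S - {a, c})" and v: "v \<in> words (S - {a, c})"
  shows "deformable Z"
proof -
  have inE: "([(a, False), (c, False), (a, True), (c, True)] @ u, v) \<in> E" by (simp add: E)
  let ?Zg = "integer_group"
  interpret Zg: group ?Zg by simp
  let ?k = "\<lambda>s. if s = c then 1 else 0 :: int"
  have uv0: "word_eval ?Zg ?k u = 0" "word_eval ?Zg ?k v = 0"
    using Zg.word_eval_trivial[OF u, of ?k] Zg.word_eval_trivial[OF v, of ?k] by auto
  have "word_eval ?Zg ?k u' = word_eval ?Zg ?k v'" if "(u', v') \<in> E" for u' v'
    using that uv0 ac(3) by (simp add: E)
  then obtain \<chi> where chi: "\<chi> \<in> hom Gp ?Zg" "\<And>s. s \<in> S \<Longrightarrow> \<chi> (gen s) = ?k s"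
    using universal[of ?Zg ?k] by auto
  have chi0: "\<chi> (gen x) = 0" if "x \<in> Z" for x using chi(2)[of x] that ac Z by auto
  have b: "gen c \<in> carrier Gp" using gen_closed ac by auto
  have "\<exists>f. deformation_on (gen c) \<chi> Z A f" if A: "A \<subseteq> Z" for A
  proof -
    interpret B: base_deformation S E Z A "gen c" \<chi>
      using Z A chi chi0 b by unfold_locales auto
    have ua: "u \<in> words (S - {a})" and va: "v \<in> words (S - {a})" and uS: "u \<in> words S" and vS: "v \<in> words S"
      using u v words_mono[of "S - {a, c}" "S - {a}"] words_mono[of "S - {a, c}" S] by blast+
    note evals = B.q.G.word_eval_closed[OF uS B.base_closed] B.q.G.word_eval_closed[OF vS B.base_closed]
      Gp.word_eval_closed[OF uS gen_closed] Gp.word_eval_closed[OF vS gen_closed]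
    have gac: "gen a \<in> carrier Gp" "gen c \<in> carrier Gp" using B.gen_carrier ac by auto
    have "group_comm Gp (gen a) (gen c) \<otimes>\<^bsub>Gp\<^esub> word_eval Gp gen u = word_eval Gp gen v"
      using relation_holds[OF inE] gac evals by (simp add: group_comm_def Gp.m_assoc)
    then have rel: "word_eval Gp gen v \<otimes>\<^bsub>Gp\<^esub> inv\<^bsub>Gp\<^esub> word_eval Gp gen u = group_comm Gp (gen a) (gen c)"
      using Gp.inv_solve_right'[of "group_comm Gp (gen a) (gen c)" "word_eval Gp gen v" "word_eval Gp gen u"]
        evals gac by simp
    let ?s0 = "\<lambda>i::int. gen c [^]\<^bsub>Gp\<^esub> i \<otimes>\<^bsub>Gp\<^esub> gen a \<otimes>\<^bsub>Gp\<^esub> inv\<^bsub>Gp\<^esub> (gen c [^]\<^bsub>Gp\<^esub> i)"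
    have Pa: "B.\<Psi>0 (gen a) = (?s0, 0)" using chi(2)[of a] ac by (simp add: shift_conj_def)
    have Pc: "B.\<Psi>0 (gen c) = shift_unit Gp"
      using chi(2)[of c] ac gac(2)
      by (simp add: shift_conj_def Gp.int_pow_mult Gp.group_word_simps)
    define w where "w = word_eval B.W B.base v \<otimes>\<^bsub>B.W\<^esub> inv\<^bsub>B.W\<^esub> word_eval B.W B.base u"
    have w: "w \<in> carrier B.W" unfolding w_def using evals by simp
    have "B.q w = B.q (B.\<Psi>0 (group_comm Gp (gen a) (gen c)))"
      unfolding w_def B.quotient_congruent[OF uS vS] rel ..
    also have "\<dots> = B.q (group_comm B.W (?s0, 0) (shift_unit Gp))"
      using gac by (simp add: B.Psi0.hom_group_comm Pa Pc)
    finally have eq: "B.q w = B.q (group_comm B.W (?s0, 0) (shift_unit Gp))" .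
    have s0: "?s0 i \<in> carrier Gp" for i using gac by simp
    obtain s where s: "\<And>i. s i \<in> carrier Gp"
      "\<And>i. B.N #>\<^bsub>Gp\<^esub> s i = B.N #>\<^bsub>Gp\<^esub> ?s0 i" "group_comm B.W (s, 0) (shift_unit Gp) = w"
      by (rule B.coset.lift_group_comm_shift_unit[OF s0 w eq]) blast
    have sW: "(s, 0) \<in> carrier B.W" "shift_unit Gp \<in> carrier B.W"
      using s(1) by (simp_all add: carrier_shift_wreath)
    have cA: "c \<notin> A" using ac A by auto
    have "deformation_on (gen c) \<chi> Z A (B.base(a := (s, 0)))"
    proof (rule B.deformation_on_update[OF ac(1) sW(1)])
      show "B.q (s, 0) = B.q (B.\<Psi>0 (gen a))" by (simp add: Pa s(2))
    next
      fix u' v' assume "(u', v') \<in> E"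
      then have uv: "u' = [(a, False), (c, False), (a, True), (c, True)] @ u" "v' = v" using E by auto
      have fc: "(B.base(a := (s, 0))) c = shift_unit Gp" using ac(3) cA by (simp add: B.base_def Pc)
      have "word_eval B.W (B.base(a := (s, 0))) u' =
          group_comm B.W (s, 0) (shift_unit Gp) \<otimes>\<^bsub>B.W\<^esub> word_eval B.W B.base u"
        unfolding uv append.simps word_eval_Cons fc B.word_eval_update[OF ua] group_comm_def
        using evals sW by (simp add: B.q.G.m_assoc)
      also have "\<dots> = word_eval B.W B.base v"
        unfolding s(3) w_def using evals by (simp add: B.q.G.group_word_simps)
      also have "\<dots> = word_eval B.W (B.base(a := (s, 0))) v'"
        unfolding uv B.word_eval_update[OF va] ..
      finally show "word_eval B.W (B.base(a := (s, 0))) u' = word_eval B.W (B.base(a := (s, 0))) v'" .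
    qed
    then show ?thesis by blast
  qed
  then show ?thesis unfolding deformable_def using chi(1) chi0 b Z by blast
qed

text \<open>In terms of \<open>a\<close> and \<open>d = a c\<close> the word \<open>a a c c\<close> becomes \<open>a d a\<^sup>-\<^sup>1 d\<close>, in which \<open>a\<close> has exponent sum
  zero. So \<open>\<chi>\<close> can be chosen with \<open>\<chi> a = 1\<close> and \<open>\<chi> d = 0\<close>, that is \<open>\<chi> c = -1\<close>; then \<open>a\<close> acts as the unit
  shift and the relation becomes an equation for the value at \<open>d\<close>.\<close>

lemma deformable_Klein_handle:
  assumes E: "E = {([(a, True), (a, True), (c, True), (c, True)] @ u, v)}"
    and ac: "a \<in> S - Z" "c \<in> S - Z" "a \<noteq> c" and Z: "Z \<subseteq> S"
    and u: "u \<in> words (S - {a, c})" and v: "v \<in> words (S - {a, c})"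
  shows "deformable Z"
proof -
  have inE: "([(a, True), (a, True), (c, True), (c, True)] @ u, v) \<in> E" by (simp add: E)
  let ?Zg = "integer_group"
  interpret Zg: group ?Zg by simp
  let ?k = "\<lambda>s. if s = a then 1 else if s = c then -1 else 0 :: int"
  have uv0: "word_eval ?Zg ?k u = 0" "word_eval ?Zg ?k v = 0"
    using Zg.word_eval_trivial[OF u, of ?k] Zg.word_eval_trivial[OF v, of ?k] by auto
  have "word_eval ?Zg ?k u' = word_eval ?Zg ?k v'" if "(u', v') \<in> E" for u' v'
    using that uv0 ac(3) by (simp add: E)
  then obtain \<chi> where chi: "\<chi> \<in> hom Gp ?Zg" "\<And>s. s \<in> S \<Longrightarrow> \<chi> (gen s) = ?k s"
    using universal[of ?Zg ?k] by auto
  have chi0: "\<chi> (gen x) = 0" if "x \<in> Z" for x using chi(2)[of x] that ac Z by auto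
  have b: "gen a \<in> carrier Gp" using gen_closed ac by auto
  have "\<exists>f. deformation_on (gen a) \<chi> Z A f" if A: "A \<subseteq> Z" for A
  proof -
    interpret B: base_deformation S E Z A "gen a" \<chi>
      using Z A chi chi0 b by unfold_locales auto
    have uc: "u \<in> words (S - {c})" and vc: "v \<in> words (S - {c})" and uS: "u \<in> words S" and vS: "v \<in> words S"
      using u v words_mono[of "S - {a, c}" "S - {c}"] words_mono[of "S - {a, c}" S] by blast+
    note evals = B.q.G.word_eval_closed[OF uS B.base_closed] B.q.G.word_eval_closed[OF vS B.base_closed]
      Gp.word_eval_closed[OF uS gen_closed] Gp.word_eval_closed[OF vS gen_closed]
    have gac: "gen a \<in> carrier Gp" "gen c \<in> carrier Gp" using B.gen_carrier ac by auto
    define d where "d = gen a \<otimes>\<^bsub>Gp\<^esub> gen c"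
    have d: "d \<in> carrier Gp" "gen c = inv\<^bsub>Gp\<^esub> gen a \<otimes>\<^bsub>Gp\<^esub> d"
      using gac by (simp_all add: d_def Gp.group_word_simps)
    let ?k = "gen a \<otimes>\<^bsub>Gp\<^esub> d \<otimes>\<^bsub>Gp\<^esub> inv\<^bsub>Gp\<^esub> gen a \<otimes>\<^bsub>Gp\<^esub> d"
    have "?k \<otimes>\<^bsub>Gp\<^esub> word_eval Gp gen u = word_eval Gp gen v"
      using relation_holds[OF inE] gac evals by (simp add: d_def Gp.group_word_simps)
    then have rel: "word_eval Gp gen v \<otimes>\<^bsub>Gp\<^esub> inv\<^bsub>Gp\<^esub> word_eval Gp gen u = ?k"
      using Gp.inv_solve_right'[of ?k "word_eval Gp gen v" "word_eval Gp gen u"]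
        evals gac d(1) by simp
    let ?s0 = "\<lambda>i::int. gen a [^]\<^bsub>Gp\<^esub> i \<otimes>\<^bsub>Gp\<^esub> d \<otimes>\<^bsub>Gp\<^esub> inv\<^bsub>Gp\<^esub> (gen a [^]\<^bsub>Gp\<^esub> i)"
    let ?t = "shift_unit Gp"
    have "\<chi> (gen a) = 1" "\<chi> (gen c) = - 1" using chi(2)[of a] chi(2)[of c] ac by auto
    then have "\<chi> d = 0" using hom_mult[OF chi(1) gac] by (simp add: d_def)
    then have Pd: "B.\<Psi>0 d = (?s0, 0)" by (simp add: shift_conj_def)
    have Pa: "B.\<Psi>0 (gen a) = ?t"
      using chi(2)[of a] ac gac(1)
      by (simp add: shift_conj_def Gp.int_pow_mult Gp.group_word_simps)
    define w where "w = word_eval B.W B.base v \<otimes>\<^bsub>B.W\<^esub> inv\<^bsub>B.W\<^esub> word_eval B.W B.base u"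
    have w: "w \<in> carrier B.W" unfolding w_def using evals by simp
    let ?kl = "\<lambda>s. ?t \<otimes>\<^bsub>B.W\<^esub> s \<otimes>\<^bsub>B.W\<^esub> inv\<^bsub>B.W\<^esub> ?t \<otimes>\<^bsub>B.W\<^esub> s"
    have "B.q w = B.q (B.\<Psi>0 ?k)"
      unfolding w_def B.quotient_congruent[OF uS vS] rel ..
    also have "B.\<Psi>0 ?k = ?kl (?s0, 0)"
      using gac d(1) by (simp add: Pa Pd)
    finally have eq: "B.q w = B.q (?kl (?s0, 0))" .
    have s0: "?s0 i \<in> carrier Gp" for i using gac d(1) by simp
    obtain s where s: "\<And>i. s i \<in> carrier Gp"
      "\<And>i. B.N #>\<^bsub>Gp\<^esub> s i = B.N #>\<^bsub>Gp\<^esub> ?s0 i" "?kl (s, 0) = w"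
      by (rule B.coset.lift_Klein_word_shift_unit[OF s0 w eq]) blast
    have sW: "(s, 0) \<in> carrier B.W" "?t \<in> carrier B.W"
      using s(1) by (simp_all add: carrier_shift_wreath)
    have s0W: "(?s0, 0) \<in> carrier B.W" using s0 by (simp add: carrier_shift_wreath)
    have aA: "a \<notin> A" using ac A by auto
    define z where "z = inv\<^bsub>B.W\<^esub> ?t \<otimes>\<^bsub>B.W\<^esub> (s, 0)"
    have z: "z \<in> carrier B.W" unfolding z_def using sW by simp
    have "deformation_on (gen a) \<chi> Z A (B.base(c := z))"
    proof (rule B.deformation_on_update[OF ac(2) z])
      have "B.q (s, 0) = B.q (?s0, 0)" by (simp add: s(2))
      then have "B.q z = B.q (inv\<^bsub>B.W\<^esub> ?t \<otimes>\<^bsub>B.W\<^esub> (?s0, 0))"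
        unfolding z_def using sW s0W by (simp del: map_wreath_simp)
      also have "inv\<^bsub>B.W\<^esub> ?t \<otimes>\<^bsub>B.W\<^esub> (?s0, 0) = B.\<Psi>0 (inv\<^bsub>Gp\<^esub> gen a \<otimes>\<^bsub>Gp\<^esub> d)"
        using gac d(1) by (simp add: Pa Pd)
      finally show "B.q z = B.q (B.\<Psi>0 (gen c))" unfolding d(2)[symmetric] .
    next
      fix u' v' assume "(u', v') \<in> E"
      then have uv: "u' = [(a, True), (a, True), (c, True), (c, True)] @ u" "v' = v" using E by auto
      have fa: "(B.base(c := z)) a = ?t" using ac(3) aA by (simp add: B.base_def Pa)
      have "word_eval B.W (B.base(c := z)) u' = ?kl (s, 0) \<otimes>\<^bsub>B.W\<^esub> word_eval B.W B.base u"
        unfolding uv append.simps word_eval_Cons fa B.word_eval_update[OF uc]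
        using evals sW by (simp add: z_def B.q.G.group_word_simps)
      also have "\<dots> = word_eval B.W B.base v"
        unfolding s(3) w_def using evals by (simp add: B.q.G.group_word_simps)
      also have "\<dots> = word_eval B.W (B.base(c := z)) v'"
        unfolding uv B.word_eval_update[OF vc] ..
      finally show "word_eval B.W (B.base(c := z)) u' = word_eval B.W (B.base(c := z)) v'" .
    qed
    then show ?thesis by blast
  qed
  then show ?thesis unfolding deformable_def using chi(1) chi0 b Z by blast
qed

end

section \<open>Surface groups\<close>

lemma left_comm_eq_list_comm: "n \<ge> 1 \<Longrightarrow> left_comm G n (r \<circ> \<sigma>) = list_comm G r (map \<sigma> [1..<Suc n])"
proof -
  assume "n \<ge> 1"
  then have "[1..<Suc n] = 1 # [2..<Suc n]" by (simp add: upt_conv_Cons numeral_2_eq_2)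
  then show ?thesis by (simp add: left_comm_def list_comm_def)
qed

lemma sym_comm_cong:
  assumes "\<And>i. i \<in> I \<Longrightarrow> R i = R' i"
  shows "sym_comm G R I = sym_comm G R' I"
proof -
  have "(\<forall>i\<in>I. r i \<in> R i) \<longleftrightarrow> (\<forall>i\<in>I. r i \<in> R' i)" for r using assms by auto
  then show ?thesis by (simp add: sym_comm_def)
qed

lemma (in group) sym_comm_subset_sym_comm_subgroup:
  assumes "n \<ge> 1"
  shows "sym_comm G R {1..n} \<subseteq> sym_comm_subgroup G n R"
  unfolding sym_comm_def sym_comm_subgroup_def
proof (rule mono_generate, rule subsetI)
  fix h assume "h \<in> {list_comm G r l | r l. l \<noteq> [] \<and> distinct l \<and> set l = {1..n} \<and> (\<forall>i\<in>{1..n}. r i \<in> R i)}"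
  then obtain r l where l: "h = list_comm G r l" "distinct l" "set l = {1..n}" "\<forall>i\<in>{1..n}. r i \<in> R i"
    by blast
  have len: "length l = n" using distinct_card[OF l(2)] l(3) by simp
  define \<sigma> where "\<sigma> i = (if i \<in> {1..n} then l ! (i - 1) else i)" for i
  have map: "map \<sigma> [1..<Suc n] = l"
    using len by (intro nth_equalityI) (auto simp: \<sigma>_def simp del: upt_Suc)
  have img: "\<sigma> ` {1..n} = {1..n}"
  proof -
    have "\<sigma> ` {1..n} = set (map \<sigma> [1..<Suc n])" by (auto simp del: upt_Suc)
    then show ?thesis unfolding map l(3) .
  qed
  then have "\<sigma> permutes {1..n}"
    by (intro bij_imp_permutes bij_betw_imageI eq_card_imp_inj_on) (auto simp: \<sigma>_def)
  moreover have "h \<in> comm_subgroup G n (R \<circ> \<sigma>)"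
    unfolding comm_subgroup_def
  proof (rule generate.incl)
    have "h = left_comm G n (r \<circ> \<sigma>)" using assms by (simp only: left_comm_eq_list_comm map l(1))
    moreover have "\<forall>i\<in>{1..n}. (r \<circ> \<sigma>) i \<in> (R \<circ> \<sigma>) i" using l(4) img by auto
    ultimately show "h \<in> {left_comm G n r | r. \<forall>i\<in>{1..n}. r i \<in> (R \<circ> \<sigma>) i}" by blast
  qed
  ultimately show "h \<in> (\<Union>\<sigma>\<in>{\<sigma>. \<sigma> permutes {1..n}}. comm_subgroup G n (R \<circ> \<sigma>))" by blast
qed

lemma (in group) sym_comm_subgroup_subset_Inter:
  assumes n: "n \<ge> 1" and R: "\<And>i. i \<in> {1..n} \<Longrightarrow> R i \<lhd> G"
  shows "sym_comm_subgroup G n R \<subseteq> (\<Inter>i\<in>{1..n}. R i)"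
proof (rule INT_greatest)
  fix j assume j: "j \<in> {1..n}"
  have sub: "subgroup (R j) G" using R[OF j] by (rule normal_imp_subgroup)
  show "sym_comm_subgroup G n R \<subseteq> R j"
    unfolding sym_comm_subgroup_def
  proof (rule generate_subgroup_incl[OF UN_least sub])
    fix \<sigma> assume "\<sigma> \<in> {\<sigma>. \<sigma> permutes {1..n}}"
    then have s: "\<sigma> permutes {1..n}" by simp
    show "comm_subgroup G n (R \<circ> \<sigma>) \<subseteq> R j"
      unfolding comm_subgroup_def
    proof (rule generate_subgroup_incl[OF subsetI sub])
      fix h assume "h \<in> {left_comm G n r | r. \<forall>i\<in>{1..n}. r i \<in> (R \<circ> \<sigma>) i}"
      then obtain r where r: "h = left_comm G n r" "\<And>i. i \<in> {1..n} \<Longrightarrow> r i \<in> R (\<sigma> i)" by auto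
      have "j \<in> \<sigma> ` {1..n}" using j by (simp only: permutes_image[OF s])
      then obtain i where i: "i \<in> {1..n}" "\<sigma> i = j" by (elim imageE) simp
      have rc: "r k \<in> carrier G" if "k \<in> {1..n}" for k
      proof -
        have "\<sigma> k \<in> {1..n}" using s that by (simp only: permutes_in_image)
        from normal_imp_subgroup[OF R[OF this]] r(2)[OF that] show ?thesis by (rule subgroup.mem_carrier)
      qed
      have "list_comm G r [1..<Suc n] \<in> R j"
      proof (rule list_comm_in_normal[OF R[OF j], where a = i])
        show "r k \<in> carrier G" if "k \<in> set [1..<Suc n]" for k
          using that by (intro rc) (simp del: upt_Suc)
      qed (use n i r(2)[OF i(1)] in auto)
      then show "h \<in> R j" using left_comm_eq_list_comm[OF n, of G r id] r(1) by (simp del: upt_Suc)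
    qed
  qed
qed

lemma upt_1_Cons: "k > 0 \<Longrightarrow> [Suc 0..<Suc k] = Suc 0 # [2..<Suc k]"
  by (simp add: upt_conv_Cons numeral_2_eq_2)

lemma concat_in_words: "(\<And>i. i \<in> set l \<Longrightarrow> f i \<in> words S) \<Longrightarrow> concat (map f l) \<in> words S"
  by (induction l) auto

lemma comm_word_in_words: "GenA i \<in> S \<Longrightarrow> GenB i \<in> S \<Longrightarrow> comm_word i \<in> words S"
  by (simp add: comm_word_def)

lemma square_word_in_words: "GenA i \<in> S \<Longrightarrow> square_word i \<in> words S"
  by (simp add: square_word_def)

lemma map_generator_in_words: "(\<And>i. i \<in> set l \<Longrightarrow> f i \<in> S) \<Longrightarrow> map (\<lambda>i. (f i, True)) l \<in> words S"
  by (auto simp: words_def)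

lemmas surface_words = concat_in_words comm_word_in_words square_word_in_words map_generator_in_words

lemma deformable_orientable:
  assumes "p = orientable_presentation g t m" "g > 0 \<or> t > 0"
  shows "\<exists>S E. p = (S, E) \<and> presentation S E \<and> presentation.deformable S E (GenX ` {1..m})"
proof -
  define S where "S = GenA ` {1..g} \<union> GenB ` {1..g} \<union> GenY ` {1..t} \<union> GenX ` {1..m}"
  define u where "u = concat (map comm_word [1..<Suc g])"
  define v where "v = boundary_word t m"
  have p: "p = (S, {(u, v)})" using assms(1) by (simp add: orientable_presentation_def S_def u_def v_def)
  have words: "u \<in> words S" "v \<in> words S"
    unfolding u_def v_def boundary_word_def
    by (auto simp: S_def simp del: upt_Suc intro!: surface_words)
  then interpret presentation S "{(u, v)}" by unfold_locales auto
  have "deformable (GenX ` {1..m})"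
  proof (cases "t > 0")
    case True
    let ?v = "map (\<lambda>j. (GenY j, True)) [2..<Suc t] @ map (\<lambda>i. (GenX i, True)) [1..<Suc m]"
    show ?thesis
    proof (rule deformable_boundary[where y = "GenY 1" and v = ?v])
      show "{(u, v)} = {(u, (GenY 1, True) # ?v)}"
        using True by (simp add: v_def boundary_word_def upt_1_Cons del: upt_Suc)
      show "GenY 1 \<in> S - GenX ` {1..m}" "GenX ` {1..m} \<subseteq> S" using True by (auto simp: S_def)
      show "u \<in> words (S - {GenY 1})" unfolding u_def
        by (auto simp: S_def simp del: upt_Suc intro!: surface_words)
      show "?v \<in> words (S - {GenY 1})"
        by (auto simp: S_def simp del: upt_Suc intro!: surface_words)
    qed
  next
    case False
    then have g: "g > 0" using assms(2) by auto
    let ?u = "concat (map comm_word [2..<Suc g])"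
    show ?thesis
    proof (rule deformable_handle[where a = "GenA 1" and c = "GenB 1" and u = ?u])
      show "{(u, v)} = {([(GenA 1, False), (GenB 1, False), (GenA 1, True), (GenB 1, True)] @ ?u, v)}"
        using g by (simp add: u_def comm_word_def upt_1_Cons del: upt_Suc)
      show "GenA 1 \<in> S - GenX ` {1..m}" "GenB 1 \<in> S - GenX ` {1..m}" "GenX ` {1..m} \<subseteq> S"
        using g by (auto simp: S_def)
      show "?u \<in> words (S - {GenA 1, GenB 1})"
        by (auto simp: S_def simp del: upt_Suc intro!: surface_words)
      show "v \<in> words (S - {GenA 1, GenB 1})" unfolding v_def boundary_word_def
        by (auto simp: S_def simp del: upt_Suc intro!: surface_words)
    qed simp
  qed
  then show ?thesis using p presentation_axioms by blast
qed

lemma deformable_nonorientable: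
  assumes "p = nonorientable_presentation h t m" "h > 1 \<or> t > 0"
  shows "\<exists>S E. p = (S, E) \<and> presentation S E \<and> presentation.deformable S E (GenX ` {1..m})"
proof -
  define S where "S = GenA ` {1..h} \<union> GenY ` {1..t} \<union> GenX ` {1..m}"
  define u where "u = concat (map square_word [1..<Suc h])"
  define v where "v = boundary_word t m"
  have p: "p = (S, {(u, v)})" using assms(1) by (simp add: nonorientable_presentation_def S_def u_def v_def)
  have words: "u \<in> words S" "v \<in> words S"
    unfolding u_def v_def boundary_word_def
    by (auto simp: S_def simp del: upt_Suc intro!: surface_words)
  then interpret presentation S "{(u, v)}" by unfold_locales auto
  have "deformable (GenX ` {1..m})"
  proof (cases "t > 0")
    case True
    let ?v = "map (\<lambda>j. (GenY j, True)) [2..<Suc t] @ map (\<lambda>i. (GenX i, True)) [1..<Suc m]"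
    show ?thesis
    proof (rule deformable_boundary[where y = "GenY 1" and v = ?v])
      show "{(u, v)} = {(u, (GenY 1, True) # ?v)}"
        using True by (simp add: v_def boundary_word_def upt_1_Cons del: upt_Suc)
      show "GenY 1 \<in> S - GenX ` {1..m}" "GenX ` {1..m} \<subseteq> S" using True by (auto simp: S_def)
      show "u \<in> words (S - {GenY 1})" unfolding u_def
        by (auto simp: S_def simp del: upt_Suc intro!: surface_words)
      show "?v \<in> words (S - {GenY 1})"
        by (auto simp: S_def simp del: upt_Suc intro!: surface_words)
    qed
  next
    case False
    then have h: "h > 1" using assms(2) by auto
    let ?u = "concat (map square_word [3..<Suc h])"
    have "[1..<Suc h] = 1 # 2 # [3..<Suc h]"
      using h by (simp add: upt_conv_Cons numeral_2_eq_2 numeral_3_eq_3)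
    then have u: "u = [(GenA 1, True), (GenA 1, True), (GenA 2, True), (GenA 2, True)] @ ?u"
      by (simp add: u_def square_word_def del: upt_Suc)
    show ?thesis
    proof (rule deformable_Klein_handle[where a = "GenA 1" and c = "GenA 2" and u = ?u])
      show "{(u, v)} = {([(GenA 1, True), (GenA 1, True), (GenA 2, True), (GenA 2, True)] @ ?u, v)}"
        unfolding u[symmetric] ..
      show "GenA 1 \<in> S - GenX ` {1..m}" "GenA 2 \<in> S - GenX ` {1..m}" "GenX ` {1..m} \<subseteq> S"
        using h by (auto simp: S_def)
      show "?u \<in> words (S - {GenA 1, GenA 2})"
        by (auto simp: S_def simp del: upt_Suc intro!: surface_words)
      show "v \<in> words (S - {GenA 1, GenA 2})" unfolding v_def boundary_word_def
        by (auto simp: S_def simp del: upt_Suc intro!: surface_words)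
    qed simp
  qed
  then show ?thesis using p presentation_axioms by blast
qed

theorem theorem4p3:
  fixes g h t m n :: nat
    and p :: "surface_gen presentation"
    and G :: "surface_gen word set set monoid"
    and P :: "nat \<Rightarrow> surface_gen set"
    and R :: "nat \<Rightarrow> surface_gen word set set set"
  assumes m: "m \<ge> 1" and n: "n \<ge> 1"
    and p: "p = orientable_presentation g t m \<and> (g > 0 \<or> t > 0) \<or>
            p = nonorientable_presentation h t m \<and> (h > 1 \<or> t > 0)"
    and G: "G = presented_group p"
    and P_subset: "\<And>i. i \<in> {1..n} \<Longrightarrow> P i \<subseteq> GenX ` {1..m}"
    and P_nonempty: "\<And>i. i \<in> {1..n} \<Longrightarrow> P i \<noteq> {}"
    and P_disjoint: "\<And>i j. i \<in> {1..n} \<Longrightarrow> j \<in> {1..n} \<Longrightarrow> i \<noteq> j \<Longrightarrow> P i \<inter> P j = {}"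
    and P_cover: "(\<Union>i\<in>{1..n}. P i) = GenX ` {1..m}"
    and R: "\<And>i. i \<in> {1..n} \<Longrightarrow> R i = normal_closure G (presented_gen p ` P i)"
  shows "(\<Inter>i\<in>{1..n}. R i) = sym_comm_subgroup G n R"
proof -
  obtain S E where SE: "p = (S, E)" "presentation S E" and
    D: "presentation.deformable S E (GenX ` {1..m})"
    using p deformable_orientable[of p g t m] deformable_nonorientable[of p h t m] by blast
  interpret presentation S E by (rule SE(2))
  have XS: "GenX ` {1..m} \<subseteq> S" using D unfolding deformable_def by blast
  have GGp: "G = Gp" using G SE(1) by simp
  have R_eq: "R i = normal_closure Gp (gen ` P i)" if "i \<in> {1..n}" for i
    using R[OF that] GGp SE(1) by simp
  \<comment> \<open>Outside \<open>{1..n}\<close> the family is continued by empty sets, so that it is normal for every index.\<close>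
  define P' where "P' i = (if i \<in> {1..n} then P i else {})" for i
  have P': "P' i \<subseteq> GenX ` {1..m}" "i \<noteq> j \<Longrightarrow> P' i \<inter> P' j = {}" for i j
    using P_subset P_disjoint[of i j] by (auto simp: P'_def)
  let ?R' = "\<lambda>i. normal_closure Gp (gen ` P' i)"
  have R': "?R' i = R i" if "i \<in> {1..n}" for i using R_eq[OF that] that by (simp add: P'_def)
  show ?thesis
  proof (rule equalityI)
    have "(\<Inter>i\<in>{1..n}. R i) = (\<Inter>i\<in>{1..n}. ?R' i)" using R' by auto
    also have "\<dots> \<subseteq> sym_comm Gp ?R' {1..n}"
      using n by (intro Inter_subset_sym_comm_of_deformable[OF D] P') auto
    also have "\<dots> = sym_comm Gp R {1..n}" using R' by (intro sym_comm_cong)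
    also have "\<dots> \<subseteq> sym_comm_subgroup Gp n R" using n by (rule Gp.sym_comm_subset_sym_comm_subgroup)
    finally show "(\<Inter>i\<in>{1..n}. R i) \<subseteq> sym_comm_subgroup G n R" by (simp only: GGp)
  next
    have "R i \<lhd> Gp" if "i \<in> {1..n}" for i
      unfolding R_eq[OF that] using P_subset[OF that] XS
      by (intro Gp.normal_closure_normal gen_subset) auto
    then show "sym_comm_subgroup G n R \<subseteq> (\<Inter>i\<in>{1..n}. R i)"
      unfolding GGp by (rule Gp.sym_comm_subgroup_subset_Inter[OF n])
  qed
qed

end
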